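(* The following two statements are equivalent. (1) (Kakeya conjecture) For every integer $n\geq 2$, every Kakeya set $K\subset\mathbb{R}^n$ has Hausdorff dimension $n$. (2) (Projection conjecture) For every integer $n\geq 2$, every Kakeya set $K\subset\mathbb{R}^n$ and every integer $k$ with $0<k<n$, there is a number $c$ such that $\dim_{\mathrm{H}}(\pi_\gamma K)=c$ for all $\gamma\in G(n,k)$.
   Context: $\dim_{\mathrm{H}}$ denotes Hausdorff dimension. $S^{n-1}=\{x\in\mathbb{R}^n : \|x\|=1\}$ with $\|\cdot\|$ the Euclidean norm. For a set of directions $\Omega\subset S^{n-1}$, a set $K(\Omega)\subset\mathbb{R}^n$ is an $\Omega$-Kakeya set if it is bounded and $K(\Omega)=\bigcup_{\theta\in\Omega} l_\theta$, where for each $\theta\in\Omega$, $l_\theta$ is a line segment of unit length centred at some point $a_\theta\in\mathbb{R}^n$ and pointing in direction $\theta$. A set $K\subset\mathbb{R}^n$ is a Kakeya set if there is a set $\Omega\subset S^{n-1}$ with non-empty interior (in $S^{n-1}$) such that $K$ is an $\Omega$-Kakeya set. $G(n,k)$ is the Grassmannian manifold of $k$-dimensional linear subspaces of $\mathbb{R}^n$, and for $\gamma\in G(n,k)$, $\pi_\gamma$ is the orthogonal projection of $\mathbb{R}^n$ onto $\gamma$. *)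

theory Defs
  imports "HOL-Analysis.Analysis"
begin

section \<open>Euclidean spaces of all finite dimensions\<close>

text \<open>
  The dimension is a bound variable of the statement, so it cannot be encoded in a type
  such as \<^typ>\<open>real ^ 'n\<close>.  All spaces \<open>\<real>\<^sup>n\<close> are therefore realised inside one real inner
  product space, the finitely supported real sequences with \<open>\<langle>x, y\<rangle> = \<Sum>i. x\<^sub>i y\<^sub>i\<close>, where
  \<open>\<real>\<^sup>n\<close> consists of the sequences vanishing at all indices \<open>i \<ge> n\<close>.  The norm and metric
  induced there are the Euclidean ones, so that the library notions (norm, bounded,
  diameter, closed segment, subspace, dim, orthogonal, ...) have their usual meaning.
  The type \<open>nat \<Rightarrow>\<^sub>0 real\<close> is not used because its library norm is the \<open>l\<^sup>1\<close> norm.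
\<close>

typedef fseq = "{f :: nat \<Rightarrow> real. finite {i. f i \<noteq> 0}}"
  morphisms coord Abs_fseq
  by (rule exI[of _ "\<lambda>_. 0"]) simp

setup_lifting type_definition_fseq

lemma finite_coord: "finite {i. coord x i \<noteq> 0}"
  using coord[of x] by simp

lemma fseq_eqI: "(\<And>i. coord x i = coord y i) \<Longrightarrow> x = y"
  by (metis coord_inject ext)

instantiation fseq :: real_vector
begin

lift_definition zero_fseq :: fseq is "\<lambda>_. 0" by simp

lift_definition plus_fseq :: "fseq \<Rightarrow> fseq \<Rightarrow> fseq" is "\<lambda>f g i. f i + g i"
  subgoal for f g
    by (rule finite_subset[of _ "{i. f i \<noteq> 0} \<union> {i. g i \<noteq> 0}"]) auto
  done

lift_definition uminus_fseq :: "fseq \<Rightarrow> fseq" is "\<lambda>f i. - f i" by simp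

lift_definition minus_fseq :: "fseq \<Rightarrow> fseq \<Rightarrow> fseq" is "\<lambda>f g i. f i - g i"
  subgoal for f g
    by (rule finite_subset[of _ "{i. f i \<noteq> 0} \<union> {i. g i \<noteq> 0}"]) auto
  done

lift_definition scaleR_fseq :: "real \<Rightarrow> fseq \<Rightarrow> fseq" is "\<lambda>r f i. r * f i"
  subgoal for r f
    by (rule finite_subset[of _ "{i. f i \<noteq> 0}"]) auto
  done

instance
  by standard (transfer; simp add: fun_eq_iff algebra_simps)+

end

lemmas coord_simps [simp] =
  zero_fseq.rep_eq plus_fseq.rep_eq uminus_fseq.rep_eq minus_fseq.rep_eq scaleR_fseq.rep_eq

lemma sum_coord_superset:
  assumes "finite A" "{i. coord x i \<noteq> 0} \<subseteq> A"
  shows "(\<Sum>i | coord x i \<noteq> 0. coord x i * coord y i) = (\<Sum>i\<in>A. coord x i * coord y i)"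
  using assms by (intro sum.mono_neutral_left) auto

instantiation fseq :: real_inner
begin

definition inner_fseq :: "fseq \<Rightarrow> fseq \<Rightarrow> real"
  where "inner_fseq x y = (\<Sum>i | coord x i \<noteq> 0. coord x i * coord y i)"

definition norm_fseq :: "fseq \<Rightarrow> real"
  where "norm_fseq x = sqrt (inner x x)"

definition dist_fseq :: "fseq \<Rightarrow> fseq \<Rightarrow> real"
  where "dist_fseq x y = norm (x - y)"

definition sgn_fseq :: "fseq \<Rightarrow> fseq"
  where "sgn_fseq x = x /\<^sub>R norm x"

definition uniformity_fseq :: "(fseq \<times> fseq) filter"
  where "uniformity_fseq = (INF e\<in>{0<..}. principal {(x, y). dist x y < e})"

definition open_fseq :: "fseq set \<Rightarrow> bool"
  where "open_fseq U = (\<forall>x\<in>U. \<forall>\<^sub>F (x', y) in uniformity. x' = x \<longrightarrow> y \<in> U)"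

instance
proof
  fix x y z :: fseq and r :: real and U :: "fseq set"
  let ?A = "{i. coord x i \<noteq> 0} \<union> {i. coord y i \<noteq> 0}"
  have A: "finite ?A" by (simp add: finite_coord)
  have E: "inner u v = (\<Sum>i\<in>?A. coord u i * coord v i)"
    if "{i. coord u i \<noteq> 0} \<subseteq> ?A" for u v
    unfolding inner_fseq_def by (rule sum_coord_superset[OF A that])
  show "inner x y = inner y x"
    by (subst (1 2) E) (auto simp: mult.commute)
  show "inner (x + y) z = inner x z + inner y z"
    by (subst (1 2 3) E) (auto simp: sum.distrib algebra_simps)
  show "inner (r *\<^sub>R x) y = r * inner x y"
    by (subst (1 2) E) (auto simp: sum_distrib_left algebra_simps)
  show "0 \<le> inner x x"
    by (simp add: inner_fseq_def sum_nonneg)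
  show "inner x x = 0 \<longleftrightarrow> x = 0"
  proof
    assume "inner x x = 0"
    then have "\<forall>i\<in>{i. coord x i \<noteq> 0}. coord x i * coord x i = 0"
      unfolding inner_fseq_def by (subst (asm) sum_nonneg_eq_0_iff) (auto simp: finite_coord)
    then show "x = 0" by (intro fseq_eqI) auto
  qed (simp add: inner_fseq_def)
  show "dist x y = norm (x - y)" by (rule dist_fseq_def)
  show "norm x = sqrt (inner x x)" by (rule norm_fseq_def)
  show "sgn x = x /\<^sub>R norm x" by (rule sgn_fseq_def)
  show "uniformity = (INF e\<in>{0<..}. principal {(x::fseq, y). dist x y < e})"
    by (rule uniformity_fseq_def)
  show "open U = (\<forall>x\<in>U. \<forall>\<^sub>F (x', y) in uniformity. x' = x \<longrightarrow> y \<in> U)"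
    by (rule open_fseq_def)
qed

end

definition Rn :: "nat \<Rightarrow> fseq set"
  where "Rn n = {x. \<forall>i\<ge>n. coord x i = 0}"

lemma inner_Rn:
  assumes "x \<in> Rn n"
  shows "inner x y = (\<Sum>i<n. coord x i * coord y i)"
proof -
  have "{i. coord x i \<noteq> 0} \<subseteq> {..<n}"
    using assms by (auto simp: Rn_def not_le[symmetric])
  then show ?thesis
    unfolding inner_fseq_def by (intro sum_coord_superset) auto
qed

lemma norm_Rn:
  assumes "x \<in> Rn n"
  shows "norm x = sqrt (\<Sum>i<n. (coord x i)\<^sup>2)"
  by (simp add: norm_eq_sqrt_inner inner_Rn[OF assms] power2_eq_square)

lemma subspace_Rn: "subspace (Rn n)"
  by (auto simp: subspace_def Rn_def)

lift_definition unit_vec :: "nat \<Rightarrow> fseq" is "\<lambda>k i. if i = k then 1 else 0"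
  by simp

lemma coord_sum: "coord (sum f A) i = (\<Sum>a\<in>A. coord (f a) i)"
  by (induction A rule: infinite_finite_induct) auto

lemma Rn_eq_span: "Rn n = span (unit_vec ` {..<n})"
proof
  show "span (unit_vec ` {..<n}) \<subseteq> Rn n"
    by (intro span_minimal subspace_Rn) (auto simp: Rn_def unit_vec.rep_eq)
  show "Rn n \<subseteq> span (unit_vec ` {..<n})"
  proof
    fix x assume x: "x \<in> Rn n"
    have "x = (\<Sum>k<n. coord x k *\<^sub>R unit_vec k)"
    proof (rule fseq_eqI)
      fix i
      have "(\<Sum>k<n. coord x k * (if i = k then 1 else 0)) = (\<Sum>k<n. if i = k then coord x k else 0)"
        by (intro sum.cong) auto
      then show "coord x i = coord (\<Sum>k<n. coord x k *\<^sub>R unit_vec k) i"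
        using x by (simp add: coord_sum unit_vec.rep_eq Rn_def)
    qed
    also have "\<dots> \<in> span (unit_vec ` {..<n})"
      by (intro span_sum span_scale span_base) auto
    finally show "x \<in> span (unit_vec ` {..<n})" .
  qed
qed

lemma dim_Rn: "dim (Rn n) = n"
proof -
  have inj: "inj unit_vec"
  proof
    fix a b assume "unit_vec a = unit_vec b"
    then have "coord (unit_vec a) a = coord (unit_vec b) a" by simp
    then show "a = b" by (simp add: unit_vec.rep_eq split: if_splits)
  qed
  have "pairwise orthogonal (unit_vec ` {..<n})"
    by (auto simp: pairwise_def orthogonal_def inner_fseq_def unit_vec.rep_eq)
  moreover have "0 \<notin> unit_vec ` {..<n}"
    by (metis (no_types, lifting) imageE unit_vec.rep_eq zero_fseq.rep_eq zero_neq_one)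
  ultimately have "independent (unit_vec ` {..<n})"
    by (rule pairwise_orthogonal_independent)
  then show ?thesis
    unfolding Rn_eq_span dim_span using inj
    by (simp add: dim_eq_card_independent card_image inj_on_subset)
qed

section \<open>Hausdorff measure and dimension\<close>

text \<open>
  The contribution \<open>(diam U)\<^sup>s\<close> of a covering set, with the conventions that the empty set
  contributes 0 and that \<open>0\<^sup>0 = 1\<close> for nonempty \<open>U\<close> (whereas \<^term>\<open>0 powr 0 = (0::real)\<close>).
\<close>

definition diam_pow :: "real \<Rightarrow> 'a::metric_space set \<Rightarrow> real"
  where "diam_pow s U = (if U = {} then 0 else if s = 0 then 1 else diameter U powr s)"

text \<open>
  Boundedness of the covering sets is required explicitly because \<^const>\<open>diameter\<close> is
  unspecified on unbounded sets.  The covering sets range over subsets of the whole type; as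
  they may be intersected with \<open>A\<close>, the value depends only on the metric space \<open>A\<close>.
\<close>

definition hausdorff_premeasure :: "real \<Rightarrow> real \<Rightarrow> 'a::metric_space set \<Rightarrow> ennreal"
  where "hausdorff_premeasure s \<delta> A =
    (INF U \<in> {U :: nat \<Rightarrow> 'a set. A \<subseteq> (\<Union>i. U i) \<and> (\<forall>i. bounded (U i) \<and> diameter (U i) \<le> \<delta>)}.
       \<Sum>i. ennreal (diam_pow s (U i)))"

definition hausdorff_measure :: "real \<Rightarrow> 'a::metric_space set \<Rightarrow> ennreal"
  where "hausdorff_measure s A = (SUP \<delta> \<in> {0<..}. hausdorff_premeasure s \<delta> A)"

definition hausdorff_dim :: "'a::metric_space set \<Rightarrow> ereal"
  where "hausdorff_dim A = Inf {ereal s | s. 0 \<le> s \<and> hausdorff_measure s A = 0}"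

section \<open>Kakeya sets\<close>

text \<open>\<open>unit_sphere n\<close> is \<open>S\<^sup>n\<^sup>-\<^sup>1\<close>, the unit sphere of \<open>\<real>\<^sup>n\<close>.\<close>

definition unit_sphere :: "nat \<Rightarrow> fseq set"
  where "unit_sphere n = sphere 0 1 \<inter> Rn n"

definition unit_segment :: "fseq \<Rightarrow> fseq \<Rightarrow> fseq set"
  where "unit_segment a \<theta> = closed_segment (a - (1/2) *\<^sub>R \<theta>) (a + (1/2) *\<^sub>R \<theta>)"

definition directed_kakeya_set :: "nat \<Rightarrow> fseq set \<Rightarrow> fseq set \<Rightarrow> bool"
  where "directed_kakeya_set n \<Omega> K \<longleftrightarrow>
    bounded K \<and> (\<exists>a. (\<forall>\<theta>\<in>\<Omega>. a \<theta> \<in> Rn n) \<and> K = (\<Union>\<theta>\<in>\<Omega>. unit_segment (a \<theta>) \<theta>))"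

definition kakeya_set :: "nat \<Rightarrow> fseq set \<Rightarrow> bool"
  where "kakeya_set n K \<longleftrightarrow>
    (\<exists>\<Omega> \<subseteq> unit_sphere n.
       top_of_set (unit_sphere n) interior_of \<Omega> \<noteq> {} \<and> directed_kakeya_set n \<Omega> K)"

section \<open>Grassmannians and orthogonal projections\<close>

definition grassmannian :: "nat \<Rightarrow> nat \<Rightarrow> fseq set set"
  where "grassmannian n k = {V. subspace V \<and> V \<subseteq> Rn n \<and> dim V = k}"

definition orth_proj :: "fseq set \<Rightarrow> fseq \<Rightarrow> fseq"
  where "orth_proj V x = (THE y. y \<in> V \<and> (\<forall>v\<in>V. orthogonal (x - y) v))"

lemma orth_proj_exists_span:
  fixes x :: "'a::real_inner"
  assumes "finite B"
  shows "\<exists>y\<in>span B. \<forall>v\<in>span B. orthogonal (x - y) v"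
  using assms
proof (induction B arbitrary: x)
  case empty
  then show ?case by (simp add: orthogonal_def)
next
  case (insert b B)
  obtain p where p: "p \<in> span B" "\<And>v. v \<in> span B \<Longrightarrow> inner (b - p) v = 0"
    using insert.IH[of b] by (auto simp: orthogonal_def)
  obtain q where q: "q \<in> span B" "\<And>v. v \<in> span B \<Longrightarrow> inner (x - q) v = 0"
    using insert.IH[of x] by (auto simp: orthogonal_def)
  define c where "c = b - p"
  define y where "y = q + (inner x c / inner c c) *\<^sub>R c"
  have sub: "span B \<subseteq> span (insert b B)" by (intro span_mono) auto
  have "c \<in> span (insert b B)"
    unfolding c_def by (rule span_diff) (use p(1) sub in \<open>auto intro: span_base\<close>)
  then have "y \<in> span (insert b B)"
    unfolding y_def using q(1) sub by (auto intro: span_add span_scale)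
  moreover have "orthogonal (x - y) v" if v: "v \<in> span (insert b B)" for v
  proof -
    have B: "inner (x - y) w = 0" if "w \<in> span B" for w
      using q(2)[OF that] p(2)[OF that] by (simp add: y_def c_def[symmetric] algebra_simps)
    have "inner q c = 0"
      using p(2)[OF q(1)] by (simp add: c_def inner_commute)
    then have C: "inner (x - y) c = 0"
      by (cases "c = 0") (simp_all add: y_def algebra_simps)
    obtain k where k: "v - k *\<^sub>R b \<in> span B"
      using v unfolding span_breakdown_eq by blast
    then have "(v - k *\<^sub>R b) + k *\<^sub>R p \<in> span B"
      using p(1) by (auto intro!: span_add span_scale)
    moreover have "v = ((v - k *\<^sub>R b) + k *\<^sub>R p) + k *\<^sub>R c"
      by (simp add: c_def algebra_simps)
    ultimately show ?thesis
      unfolding orthogonal_def using B C by (metis add.right_neutral inner_add_right inner_scaleR_right mult_zero_right)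
  qed
  ultimately show ?case by blast
qed

lemma orth_proj_unique:
  fixes x :: "'a::real_inner"
  assumes "subspace V" "y \<in> V" "\<forall>v\<in>V. orthogonal (x - y) v"
    and "z \<in> V" "\<forall>v\<in>V. orthogonal (x - z) v"
  shows "y = z"
proof -
  have "z - y \<in> V" using assms by (simp add: subspace_diff)
  then have "inner (x - y) (z - y) = 0" "inner (x - z) (z - y) = 0"
    using assms by (auto simp: orthogonal_def)
  then have "inner (z - y) (z - y) = 0" by (simp add: inner_diff_left)
  then show ?thesis by simp
qed

lemma orth_proj:
  assumes "V \<in> grassmannian n k"
  shows "orth_proj V x \<in> V" "v \<in> V \<Longrightarrow> orthogonal (x - orth_proj V x) v"
proof -
  have V: "subspace V" "V \<subseteq> span (unit_vec ` {..<n})"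
    using assms by (auto simp: grassmannian_def Rn_eq_span)
  obtain B where B: "B \<subseteq> V" "independent B" "V \<subseteq> span B"
    using basis_exists[of V] by metis
  then have "finite B"
    using independent_span_bound[of "unit_vec ` {..<n}" B] V by auto
  moreover have "span B = V"
    using B V by (meson antisym span_minimal)
  ultimately obtain y where y: "y \<in> V" "\<forall>v\<in>V. orthogonal (x - y) v"
    using orth_proj_exists_span[of B x] by auto
  then have "\<exists>!y. y \<in> V \<and> (\<forall>v\<in>V. orthogonal (x - y) v)"
    by (auto intro: orth_proj_unique[OF V(1)])
  from theI'[OF this] have "orth_proj V x \<in> V \<and> (\<forall>v\<in>V. orthogonal (x - orth_proj V x) v)"
    unfolding orth_proj_def .
  then show "orth_proj V x \<in> V" "v \<in> V \<Longrightarrow> orthogonal (x - orth_proj V x) v" by auto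
qed

end

theory Submission
  imports Defs
begin

text \<open>
  Assume the Kakeya conjecture, and project a Kakeya set in \<open>\<real>\<^sup>n\<close> onto a \<open>k\<close>-dimensional subspace.
  Among its directions there is a small \<open>(k-1)\<close>-dimensional spherical slice whose members all
  project to vectors of one common length \<open>l > 0\<close> (\<open>unit_sphere_slice\<close>), and the normalised
  projections fill an open set of directions of the subspace.  Up to the scale \<open>l\<close>, the projection
  therefore contains a Kakeya set of \<open>\<real>\<^sup>k\<close> (\<open>kakeya_set_in_projection\<close>), and so it has dimension \<open>k\<close>: by the
  conjecture if \<open>k \<ge> 2\<close>, and because it contains a segment if \<open>k = 1\<close>.  The constant is \<open>c = k\<close>.

  Conversely, let \<open>K\<close> be a Kakeya set in \<open>\<real>\<^sup>n\<close>.  Apart from boundedness, nothing restricts where the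
  segments of a Kakeya set are centred, so there is a Kakeya set in \<open>\<real>\<^sup>2\<^sup>n = \<real>\<^sup>n \<oplus> W\<close> whose projection onto \<open>\<real>\<^sup>n\<close> stays inside \<open>K\<close>, but whose
  centres project onto a whole ball of \<open>W\<close> (\<open>kakeya_set_extension\<close>).  By the projection conjecture with
  \<open>k = n\<close> both projections have the same dimension.  The second has dimension at least \<open>n\<close>, hence so
  does \<open>K\<close>.

  Besides monotonicity, three facts about Hausdorff dimension enter: it does not increase under Lipschitz maps, it is
  at most \<open>k\<close> for bounded subsets of a \<open>k\<close>-dimensional subspace (a count of grid cells), and at least \<open>k\<close> for sets
  that contain a ball of one (a comparison with Lebesgue measure).
\<close>

section \<open>Hausdorff dimension\<close>

text \<open>
  The dimension is determined by the exponents with vanishing measure, so covers with arbitrarily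
  small sums are all that is ever needed from the nested infimum and supremum.
\<close>

lemma hausdorff_measure_eq_0_iff:
  "hausdorff_measure s A = 0 \<longleftrightarrow>
    (\<forall>\<delta>>0. \<forall>\<epsilon>>0. \<exists>U. A \<subseteq> (\<Union>i. U i) \<and> (\<forall>i. bounded (U i) \<and> diameter (U i) \<le> \<delta>) \<and>
       (\<Sum>i. ennreal (diam_pow s (U i))) < ennreal \<epsilon>)"
    (is "_ \<longleftrightarrow> (\<forall>\<delta>>0. \<forall>\<epsilon>>0. ?C \<delta> \<epsilon>)")
proof -
  have "hausdorff_premeasure s \<delta> A = 0 \<longleftrightarrow> (\<forall>\<epsilon>>0. ?C \<delta> \<epsilon>)" for \<delta>
  proof -
    have "hausdorff_premeasure s \<delta> A < ennreal \<epsilon> \<longleftrightarrow> ?C \<delta> \<epsilon>" for \<epsilon>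
      unfolding hausdorff_premeasure_def INF_less_iff by auto
    moreover have "x = 0 \<longleftrightarrow> (\<forall>\<epsilon>>0. x < ennreal \<epsilon>)" for x :: ennreal
    proof
      assume "\<forall>\<epsilon>>0. x < ennreal \<epsilon>"
      then have "x \<le> 0 + ennreal e" if "0 < e" for e
        using that by (simp add: less_imp_le)
      then have "x \<le> 0" by (rule ennreal_le_epsilon)
      then show "x = 0" by simp
    qed simp
    ultimately show ?thesis by simp
  qed
  moreover have "hausdorff_measure s A = 0 \<longleftrightarrow> (\<forall>\<delta>>0. hausdorff_premeasure s \<delta> A = 0)"
    unfolding hausdorff_measure_def bot_ennreal[symmetric] SUP_bot_conv by auto
  ultimately show ?thesis by auto
qed

lemma diameter_le_dist:
  assumes "\<And>x y. x \<in> S \<Longrightarrow> y \<in> S \<Longrightarrow> dist x y \<le> d" "0 \<le> d"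
  shows "diameter S \<le> d"
  using assms by (auto simp: diameter_def intro!: cSUP_least)

text \<open>
  The images of the pieces of a cover form a cover whose sum grows by at most the factor
  \<open>M\<^sup>s\<close>, where \<open>M\<close> is a Lipschitz constant.  Isometries, rescalings and orthogonal projections
  are handled through this one inequality.
\<close>

lemma hausdorff_dim_lipschitz:
  fixes f :: "'a::metric_space \<Rightarrow> 'b::metric_space"
  assumes lip: "\<And>x y. x \<in> A \<Longrightarrow> y \<in> A \<Longrightarrow> dist (f x) (f y) \<le> L * dist x y"
  shows "hausdorff_dim (f ` A) \<le> hausdorff_dim A"
proof -
  \<comment> \<open>A positive constant is needed to divide by it below; the given one may be \<open>0\<close> or negative.\<close>
  define M where "M = max L 1"
  have M: "M \<ge> 1" by (simp add: M_def)
  have lipM: "dist (f x) (f y) \<le> M * dist x y" if "x \<in> A" "y \<in> A" for x y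
  proof -
    have "L * dist x y \<le> M * dist x y"
      by (intro mult_right_mono) (auto simp: M_def)
    with lip[OF that] show ?thesis by linarith
  qed
  have "hausdorff_measure s (f ` A) = 0" if s: "s \<ge> 0" "hausdorff_measure s A = 0" for s
    unfolding hausdorff_measure_eq_0_iff
  proof (intro allI impI)
    fix \<delta> \<epsilon> :: real assume "0 < \<delta>" "0 < \<epsilon>"
    then have "\<delta> / M > 0" "\<epsilon> / M powr s > 0" using M by auto
    then obtain U where U: "A \<subseteq> (\<Union>i. U i)" "\<And>i. bounded (U i)" "\<And>i. diameter (U i) \<le> \<delta> / M"
        "(\<Sum>i. ennreal (diam_pow s (U i))) < ennreal (\<epsilon> / M powr s)"
      using s(2) unfolding hausdorff_measure_eq_0_iff by meson
    define W where "W i = f ` (A \<inter> U i)" for i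
    have d: "dist (f x) (f y) \<le> M * diameter (U i)" if "x \<in> A \<inter> U i" "y \<in> A \<inter> U i" for x y i
    proof -
      have "M * dist x y \<le> M * diameter (U i)"
        using that U(2)[of i] M by (intro mult_left_mono diameter_bounded_bound) auto
      then show ?thesis using lipM[of x y] that by auto
    qed
    have bW: "bounded (W i)" for i
    proof (cases "A \<inter> U i = {}")
      case False
      then obtain x where "x \<in> A \<inter> U i" by blast
      then show ?thesis unfolding bounded_def W_def using d by (metis imageE)
    qed (simp add: W_def)
    have dW: "diameter (W i) \<le> M * diameter (U i)" for i
      using d[of _ i] M U(2)[of i] by (intro diameter_le_dist) (auto simp: W_def diameter_ge_0)
    have "diameter (W i) \<le> \<delta>" for i
    proof -
      have "M * diameter (U i) \<le> M * (\<delta> / M)"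
        using M U(3) by (intro mult_left_mono) auto
      then show ?thesis using dW[of i] M by simp
    qed
    moreover have "f ` A \<subseteq> (\<Union>i. W i)" using U(1) by (fastforce simp: W_def)
    moreover have "(\<Sum>i. ennreal (diam_pow s (W i))) < ennreal \<epsilon>"
    proof -
      have "diam_pow s (W i) \<le> M powr s * diam_pow s (U i)" for i
      proof -
        have "diameter (W i) powr s \<le> (M * diameter (U i)) powr s"
          using s(1) dW diameter_ge_0[OF bW] by (intro powr_mono2) auto
        also have "\<dots> = M powr s * diameter (U i) powr s"
          by (rule powr_mult)
        finally show ?thesis using M by (auto simp: diam_pow_def W_def)
      qed
      then have "(\<Sum>i. ennreal (diam_pow s (W i))) \<le> (\<Sum>i. ennreal (M powr s) * ennreal (diam_pow s (U i)))"
        by (intro suminf_le) (auto simp: ennreal_mult'[symmetric] intro!: ennreal_leI)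
      also have "\<dots> = ennreal (M powr s) * (\<Sum>i. ennreal (diam_pow s (U i)))" by simp
      also have "\<dots> < ennreal (M powr s) * ennreal (\<epsilon> / M powr s)"
        using U(4) M by (intro ennreal_mult_strict_left_mono) auto
      also have "\<dots> = ennreal \<epsilon>" using M by (simp add: ennreal_mult'[symmetric])
      finally show ?thesis .
    qed
    ultimately show "\<exists>U. f ` A \<subseteq> (\<Union>i. U i) \<and> (\<forall>i. bounded (U i) \<and> diameter (U i) \<le> \<delta>) \<and>
       (\<Sum>i. ennreal (diam_pow s (U i))) < ennreal \<epsilon>" using bW by blast
  qed
  then show ?thesis unfolding hausdorff_dim_def by (intro Inf_superset_mono) blast
qed

lemma hausdorff_dim_mono: "A \<subseteq> B \<Longrightarrow> hausdorff_dim A \<le> hausdorff_dim B"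
proof -
  assume "A \<subseteq> B"
  then have "hausdorff_measure s A = 0" if "hausdorff_measure s B = 0" for s
    using that unfolding hausdorff_measure_eq_0_iff by (meson subset_trans)
  then show ?thesis unfolding hausdorff_dim_def by (intro Inf_superset_mono) auto
qed

section \<open>Dimension of bounded sets and of balls in \<open>\<real>\<^sup>k\<close>\<close>

lemma norm_unit_vec [simp]: "norm (unit_vec i) = 1"
  by (simp add: norm_eq_sqrt_inner inner_fseq_def unit_vec.rep_eq)

lemma inner_unit_vec: "inner x (unit_vec i) = coord x i"
  by (subst inner_commute) (simp add: inner_fseq_def unit_vec.rep_eq)

lemma abs_coord_le_norm: "\<bar>coord x i\<bar> \<le> norm x"
  using Cauchy_Schwarz_ineq2[of x "unit_vec i"] by (simp add: inner_unit_vec)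

lemma coord_sum_unit_vec:
  assumes "finite S"
  shows "coord (\<Sum>j\<in>S. f j *\<^sub>R unit_vec j) i = (if i \<in> S then f i else 0)"
proof -
  have "(\<Sum>j\<in>S. f j * (if i = j then 1 else 0)) = (\<Sum>j\<in>S. if i = j then f j else 0)"
    by (intro sum.cong) auto
  then show ?thesis using assms by (simp add: coord_sum unit_vec.rep_eq)
qed

lemma sum_unit_vec_in_Rn: "(\<Sum>j<k. f j *\<^sub>R unit_vec j) \<in> Rn k"
  by (simp add: Rn_def coord_sum_unit_vec)

lemma Rn_expansion: "x \<in> Rn k \<Longrightarrow> x = (\<Sum>j<k. coord x j *\<^sub>R unit_vec j)"
  by (rule fseq_eqI) (auto simp: coord_sum_unit_vec Rn_def)

lemma norm_Rn_le:
  assumes "x \<in> Rn k" "\<And>j. j < k \<Longrightarrow> \<bar>coord x j\<bar> \<le> r"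
  shows "norm x \<le> real k * r"
proof -
  have "norm x = norm (\<Sum>j<k. coord x j *\<^sub>R unit_vec j)" using Rn_expansion[OF assms(1)] by simp
  also have "\<dots> \<le> (\<Sum>j<k. \<bar>coord x j\<bar>)" by (rule order.trans[OF norm_sum]) simp
  also have "\<dots> \<le> real k * r" using sum_bounded_above[of "{..<k}" "\<lambda>j. \<bar>coord x j\<bar>" r] assms(2) by simp
  finally show ?thesis .
qed

text \<open>
  A cube of side \<open>2M\<close> is cut into \<open>m\<^sup>k\<close> cells of diameter at most \<open>2Mk/m\<close>.  The resulting sum is
  \<open>(2Mk)\<^sup>s m\<^sup>k\<^sup>-\<^sup>s\<close>, which tends to \<open>0\<close> as \<open>m\<close> grows whenever \<open>s > k\<close>.
\<close>

lemma hausdorff_dim_Rn_le: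
  assumes "A \<subseteq> Rn k" "bounded A"
  shows "hausdorff_dim A \<le> ereal (real k)"
proof -
  \<comment> \<open>The strict bound keeps every point off the upper faces of the cube, so that rounding
    down never yields the index \<open>m\<close>.\<close>
  obtain M where M: "M > 0" "\<And>x. x \<in> A \<Longrightarrow> norm x < M"
    using assms(2) unfolding bounded_pos_less by blast
  have "hausdorff_measure s A = 0" if s: "s > real k" for s
    unfolding hausdorff_measure_eq_0_iff
  proof (intro allI impI)
    fix \<delta> \<epsilon> :: real assume pos: "0 < \<delta>" "0 < \<epsilon>"
    define D where "D m = real k * (2 * M / real m)" for m
    have s0: "s > 0" using s by (simp add: order.strict_trans1[of 0 "real k"])
    have "(\<lambda>m. D m) \<longlonglongrightarrow> 0" unfolding D_def
      by (intro tendsto_mult_right_zero) (rule lim_const_over_n)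
    then have "\<forall>\<^sub>F m in sequentially. D m < \<delta>" using pos(1) by (rule order_tendstoD)
    moreover have "(\<lambda>m. (real k * (2 * M)) powr s * real m powr (real k - s)) \<longlonglongrightarrow> 0"
      using s by (intro tendsto_mult_right_zero tendsto_neg_powr filterlim_real_sequentially) auto
    then have "\<forall>\<^sub>F m in sequentially. (real k * (2 * M)) powr s * real m powr (real k - s) < \<epsilon>"
      using pos by (auto dest: order_tendstoD)
    ultimately have ev: "\<forall>\<^sub>F m in sequentially. m > 0 \<and> D m < \<delta> \<and>
        (real k * (2 * M)) powr s * real m powr (real k - s) < \<epsilon>"
      using eventually_gt_at_top[of "0::nat"] by eventually_elim auto
    obtain m :: nat where m: "m > 0" "D m < \<delta>"
        "(real k * (2 * M)) powr s * real m powr (real k - s) < \<epsilon>"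
      using eventually_happens'[OF _ ev] by auto
    have D0: "D m \<ge> 0" using M m by (simp add: D_def)
    define h where "h = 2 * M / real m"
    have h: "h > 0" "real m * h = 2 * M" using M m by (auto simp: h_def)
    define cell where "cell f = {x \<in> Rn k. \<forall>j<k. real (f j) * h \<le> coord x j + M \<and> coord x j + M \<le> real (f j) * h + h}"
      for f :: "nat \<Rightarrow> nat"
    define F where "F = PiE {..<k} (\<lambda>_. {..<m})"
    have F: "finite F" "card F = m ^ k" by (auto simp: F_def finite_PiE card_PiE)
    obtain g where g: "bij_betw g {0..<card F} F" using ex_bij_betw_nat_finite[OF F(1)] by blast
    define U where "U i = (if i < m ^ k then cell (g i) else {})" for i
    have dist_cell: "dist x y \<le> D m" if "x \<in> cell f" "y \<in> cell f" for x y f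
    proof -
      have "norm (x - y) \<le> real k * h"
      proof (rule norm_Rn_le)
        show "x - y \<in> Rn k" using that by (auto simp: cell_def Rn_def)
        fix j assume "j < k"
        then have "real (f j) * h \<le> coord x j + M \<and> coord x j + M \<le> real (f j) * h + h"
          "real (f j) * h \<le> coord y j + M \<and> coord y j + M \<le> real (f j) * h + h"
          using that by (auto simp: cell_def)
        then show "\<bar>coord (x - y) j\<bar> \<le> h" by (simp add: abs_le_iff)
      qed
      then show ?thesis by (simp add: dist_norm D_def h_def)
    qed
    have bdd: "bounded (U i)" for i
    proof (cases "U i = {}")
      case False
      then obtain x where "x \<in> U i" by blast
      then show ?thesis unfolding bounded_def U_def using dist_cell by (metis empty_iff)
    qed simp
    have diam: "diameter (U i) \<le> D m" for i
      using dist_cell D0 by (intro diameter_le_dist) (auto simp: U_def split: if_splits)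
    have "A \<subseteq> (\<Union>i. U i)"
    proof
      fix x assume x: "x \<in> A"
      define f where "f = restrict (\<lambda>j. nat \<lfloor>(coord x j + M) / h\<rfloor>) {..<k}"
      have fl: "real (f j) \<le> (coord x j + M) / h" "(coord x j + M) / h < real (f j) + 1"
        if "j < k" for j
      proof -
        have "(coord x j + M) / h \<ge> 0"
          using abs_coord_le_norm[of x j] M(2)[OF x] h(1) by (intro divide_nonneg_pos) auto
        then show "real (f j) \<le> (coord x j + M) / h" "(coord x j + M) / h < real (f j) + 1"
          using that unfolding f_def by simp_all
      qed
      have "f j < m" if "j < k" for j
      proof -
        have "(coord x j + M) / h < real m"
          using abs_coord_le_norm[of x j] M(2)[OF x] h(2) by (subst pos_divide_less_eq[OF h(1)]) linarith
        then show ?thesis using fl(1)[OF that] by linarith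
      qed
      then have "f \<in> F" by (auto simp: F_def f_def)
      then obtain i where i: "i < m ^ k" "g i = f"
        using g F(2) by (auto simp: bij_betw_def)
      have "real (f j) * h \<le> coord x j + M" "coord x j + M \<le> real (f j) * h + h" if "j < k" for j
        using fl[OF that] unfolding pos_le_divide_eq[OF h(1)] pos_divide_less_eq[OF h(1)]
        by (auto simp: distrib_right)
      then have "x \<in> cell f" using x assms(1) by (auto simp: cell_def)
      then show "x \<in> (\<Union>i. U i)" using i by (auto simp: U_def)
    qed
    moreover have "(\<Sum>i. ennreal (diam_pow s (U i))) < ennreal \<epsilon>"
    proof -
      have "(\<Sum>i. ennreal (diam_pow s (U i))) = (\<Sum>i<m^k. ennreal (diam_pow s (U i)))"
        by (intro suminf_finite) (auto simp: U_def diam_pow_def)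
      also have "\<dots> \<le> (\<Sum>i<m^k. ennreal (D m powr s))"
        using s0 diam diameter_ge_0[OF bdd]
        by (intro sum_mono ennreal_leI) (auto simp: diam_pow_def intro!: powr_mono2)
      also have "\<dots> = ennreal (real (m ^ k) * D m powr s)"
        by (simp add: ennreal_mult' ennreal_of_nat_eq_real_of_nat)
      also have "real (m ^ k) * D m powr s = (real k * (2 * M)) powr s * real m powr (real k - s)"
        using m M by (simp add: D_def powr_divide powr_mult powr_diff powr_realpow)
      finally show ?thesis using ennreal_lessI[OF pos(2) m(3)] by (rule le_less_trans)
    qed
    ultimately show "\<exists>U. A \<subseteq> (\<Union>i. U i) \<and> (\<forall>i. bounded (U i) \<and> diameter (U i) \<le> \<delta>) \<and>
       (\<Sum>i. ennreal (diam_pow s (U i))) < ennreal \<epsilon>"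
      using bdd diam m(2) by (meson less_imp_le order.trans)
  qed
  then have "hausdorff_dim A \<le> ereal s" if "s > real k" for s
    unfolding hausdorff_dim_def using that by (intro Inf_lower) auto
  then have "hausdorff_dim A \<le> ereal (real k) + ereal e" if "e > 0" for e using that by simp
  then show ?thesis by (rule ereal_le_epsilon2)
qed

text \<open>
  A set of diameter \<open>d\<close> lies in a cube of side \<open>2d\<close> around any of its points, so the volume
  of a cube is at most the sum of the volumes \<open>(2d)\<^sup>k\<close> over a cover.  Volume is the product
  of \<open>k\<close> copies of Lebesgue measure, indexed by \<open>{..<k}\<close>, since \<open>k\<close> is a variable.
\<close>

lemma volume_le_sum_diameter:
  assumes cov: "{x \<in> Rn k. \<forall>j<k. \<bar>coord x j - c j\<bar> \<le> r} \<subseteq> (\<Union>i. U i)"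
    and bdd: "\<And>i. bounded (U i)" and r: "r \<ge> 0"
  shows "ennreal ((2 * r) ^ k) \<le> (\<Sum>i. ennreal (if U i = {} then 0 else (2 * diameter (U i)) ^ k))"
proof -
  define \<mu> where "\<mu> = PiM {..<k} (\<lambda>_. lborel :: real measure)"
  interpret product_sigma_finite "\<lambda>_::nat. lborel :: real measure"
    by (rule product_sigma_finite.intro) (rule sigma_finite_lborel)
  define box where "box c r = PiE {..<k} (\<lambda>j. {c j - r..c j + r})" for c :: "nat \<Rightarrow> real" and r
  have meas: "box c r \<in> sets \<mu>" for c r
    unfolding box_def \<mu>_def by (intro sets_PiM_I_finite) auto
  have vol: "emeasure \<mu> (box c r) = ennreal ((2 * r) ^ k)" if "r \<ge> 0" for c r
    unfolding box_def \<mu>_def using that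
    by (subst emeasure_PiM) (auto simp: prod_ennreal ennreal_power algebra_simps)
  define p where "p i = (SOME x. x \<in> U i)" for i
  define B where "B i = (if U i = {} then {} else box (coord (p i)) (diameter (U i)))" for i
  have "box c r \<subseteq> (\<Union>i. B i)"
  proof
    fix f assume f: "f \<in> box c r"
    define x where "x = (\<Sum>j<k. f j *\<^sub>R unit_vec j)"
    have x: "coord x j = f j" if "j < k" for j using that by (simp add: x_def coord_sum_unit_vec)
    have "\<bar>f j - c j\<bar> \<le> r" if "j < k" for j
      using f that by (force simp: box_def PiE_iff abs_le_iff)
    then have "x \<in> {x \<in> Rn k. \<forall>j<k. \<bar>coord x j - c j\<bar> \<le> r}"
      using x by (simp add: x_def sum_unit_vec_in_Rn)
    then obtain i where i: "x \<in> U i" using cov by blast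
    then have "p i \<in> U i" unfolding p_def by (rule someI)
    then have "norm (x - p i) \<le> diameter (U i)"
      using diameter_bounded_bound[OF bdd i] by (simp add: dist_norm)
    then have "\<bar>f j - coord (p i) j\<bar> \<le> diameter (U i)" if "j < k" for j
      using abs_coord_le_norm[of "x - p i" j] x[OF that] by simp
    then have "f \<in> B i" using i f by (force simp: B_def box_def PiE_iff abs_le_iff)
    then show "f \<in> (\<Union>i. B i)" by blast
  qed
  then have "emeasure \<mu> (box c r) \<le> emeasure \<mu> (\<Union>i. B i)"
    by (intro emeasure_mono) (auto simp: B_def meas)
  also have "\<dots> \<le> (\<Sum>i. emeasure \<mu> (B i))"
    by (intro emeasure_subadditive_countably) (auto simp: B_def meas)
  also have "\<dots> = (\<Sum>i. ennreal (if U i = {} then 0 else (2 * diameter (U i)) ^ k))"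
    by (intro suminf_cong) (auto simp: B_def vol diameter_ge_0 bdd)
  finally show ?thesis using vol[OF r] by simp
qed

text \<open>
  For covers by sets of diameter at most \<open>1\<close> and for \<open>s < k\<close>, the sum of the \<open>diam\<^sup>s\<close> dominates
  the sum of the \<open>diam\<^sup>k\<close>, which is bounded below by the volume of a cube inside the ball.
\<close>

lemma hausdorff_dim_Rn_ge:
  assumes "k > 0" "r > 0" "a \<in> Rn k" and A: "ball a r \<inter> Rn k \<subseteq> A"
  shows "hausdorff_dim A \<ge> ereal (real k)"
  unfolding hausdorff_dim_def
proof (intro Inf_greatest, clarify, rule ccontr)
  fix s assume s: "0 \<le> s" "hausdorff_measure s A = 0" "\<not> ereal (real k) \<le> ereal s"
  \<comment> \<open>Half the side of a cube that fits into the ball, by the bound \<open>norm \<le> k * max\<close>.\<close>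
  define q where "q = r / (2 * real k)"
  have q: "q > 0" "real k * q < r" using assms by (auto simp: q_def field_simps)
  have cube: "{x \<in> Rn k. \<forall>j<k. \<bar>coord x j - coord a j\<bar> \<le> q} \<subseteq> A"
  proof
    fix x assume x: "x \<in> {x \<in> Rn k. \<forall>j<k. \<bar>coord x j - coord a j\<bar> \<le> q}"
    then have "norm (x - a) \<le> real k * q"
      using assms(3) by (intro norm_Rn_le) (auto intro: subspace_diff[OF subspace_Rn])
    then show "x \<in> A" using A x q(2) by (auto simp: dist_norm norm_minus_commute)
  qed
  have "q ^ k > 0" using q by simp
  then obtain U where U: "A \<subseteq> (\<Union>i. U i)" "\<And>i. bounded (U i)" "\<And>i. diameter (U i) \<le> 1"
      "(\<Sum>i. ennreal (diam_pow s (U i))) < ennreal (q ^ k)"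
    using s(2) unfolding hausdorff_measure_eq_0_iff by (meson zero_less_one)
  have "ennreal ((2 * q) ^ k) \<le> (\<Sum>i. ennreal (if U i = {} then 0 else (2 * diameter (U i)) ^ k))"
    using cube U q by (intro volume_le_sum_diameter[where c = "coord a"]) auto
  also have "\<dots> \<le> (\<Sum>i. ennreal (2 ^ k) * ennreal (diam_pow s (U i)))"
  proof (intro suminf_le)
    fix i
    have d: "0 \<le> diameter (U i)" "diameter (U i) \<le> 1" using U by (auto simp: diameter_ge_0)
    have "diameter (U i) ^ k \<le> diam_pow s (U i)" if "U i \<noteq> {}"
    proof (cases "s = 0 \<or> diameter (U i) = 0")
      case True
      then show ?thesis using d that assms(1) by (auto simp: diam_pow_def power_le_one power_0_left)
    next
      case False
      then have "diameter (U i) ^ k = diameter (U i) powr real k" using d by (simp add: powr_realpow)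
      also have "\<dots> \<le> diameter (U i) powr s" using s d False by (intro powr_mono') auto
      finally show ?thesis using that False by (simp add: diam_pow_def)
    qed
    then have "(if U i = {} then 0 else (2 * diameter (U i)) ^ k) \<le> 2 ^ k * diam_pow s (U i)"
      by (simp add: power_mult_distrib diam_pow_def[of _ "{}"])
    then show "ennreal (if U i = {} then 0 else (2 * diameter (U i)) ^ k)
        \<le> ennreal (2 ^ k) * ennreal (diam_pow s (U i))"
      by (simp add: ennreal_mult'[symmetric] ennreal_leI)
  qed auto
  also have "\<dots> = ennreal (2 ^ k) * (\<Sum>i. ennreal (diam_pow s (U i)))" by simp
  also have "\<dots> < ennreal (2 ^ k) * ennreal (q ^ k)"
    using U(4) by (intro ennreal_mult_strict_left_mono) auto
  also have "\<dots> = ennreal ((2 * q) ^ k)"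
    by (simp add: ennreal_mult'[symmetric] power_mult_distrib)
  finally show False by simp
qed

section \<open>Orthonormal coordinates on a subspace\<close>

lemma orth_proj_eqI:
  assumes "V \<in> grassmannian n k" "y \<in> V" "\<And>v. v \<in> V \<Longrightarrow> orthogonal (x - y) v"
  shows "orth_proj V x = y"
  using assms orth_proj[OF assms(1)] by (intro orth_proj_unique[of V]) (auto simp: grassmannian_def)

text \<open>
  One step of the Gram--Schmidt process: split a basis vector off, take a frame of the span of
  the others, and complete it by the normalised residual of the projection onto that span.
\<close>

lemma grassmannian_orthonormal_frame:
  assumes "V \<in> grassmannian n k"
  shows "\<exists>e. (\<forall>i<k. \<forall>j<k. inner (e i) (e j) = (if i = j then 1 else 0)) \<and> span (e ` {..<k}) = V"
  using assms
proof (induction k arbitrary: V)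
  case 0
  then have "V \<subseteq> span (unit_vec ` {..<n})" "dim V = 0" "subspace V"
    by (auto simp: grassmannian_def Rn_eq_span)
  obtain B where B: "B \<subseteq> V" "independent B" "V \<subseteq> span B" "card B = dim V"
    using basis_exists[of V] by metis
  have "finite B"
    using independent_span_bound[of "unit_vec ` {..<n}" B] B \<open>V \<subseteq> span (unit_vec ` {..<n})\<close> by auto
  then have "V = {0}" using B \<open>dim V = 0\<close> subspace_0[OF \<open>subspace V\<close>] by auto
  then show ?case by auto
next
  case (Suc k)
  then have V: "subspace V" "V \<subseteq> Rn n" "dim V = Suc k" by (auto simp: grassmannian_def)
  obtain B where B: "B \<subseteq> V" "independent B" "V \<subseteq> span B" "card B = Suc k"
    using basis_exists[of V] V(3) by metis
  then obtain b where b: "b \<in> B" by (metis card.empty equals0I nat.distinct(1))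
  define W where "W = span (B - {b})"
  have indW: "independent (B - {b})" using B(2) by (rule independent_mono) auto
  have WV: "W \<subseteq> V" unfolding W_def using B(1) V(1) by (intro span_minimal) auto
  have W: "W \<in> grassmannian n k"
    using WV V(2) b B(4) dim_eq_card_independent[OF indW]
    by (auto simp: grassmannian_def W_def)
  obtain e where e: "\<And>i j. i < k \<Longrightarrow> j < k \<Longrightarrow> inner (e i) (e j) = (if i = j then 1 else 0)"
      "span (e ` {..<k}) = W"
    using Suc.IH[OF W] by blast
  define c where "c = b - orth_proj W b"
  have cW: "inner c w = 0" if "w \<in> W" for w
    using orth_proj(2)[OF W that, of b] by (simp add: c_def orthogonal_def)
  have "b \<notin> W" using B(2) b by (auto simp: W_def dependent_def)
  then have c: "c \<noteq> 0" using orth_proj(1)[OF W, of b] by (auto simp: c_def)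
  define e' where "e' = e(k := c /\<^sub>R norm c)"
  have eW: "e i \<in> W" if "i < k" for i using that e(2) by (auto intro: span_base)
  have c1: "inner c c = norm c * norm c" by (simp add: dot_square_norm power2_eq_square)
  have "inner (e' i) (e' j) = (if i = j then 1 else 0)" if ij: "i < Suc k" "j < Suc k" for i j
  proof -
    consider "i < k" "j < k" | "i = k" "j = k" | "i < k" "j = k" | "i = k" "j < k"
      using ij by linarith
    then show ?thesis
    proof cases
      case 3
      then have "inner (e i) c = 0" using cW[OF eW] by (simp add: inner_commute)
      then show ?thesis using 3 by (simp add: e'_def)
    next
      case 2
      then show ?thesis using c c1 by (simp add: e'_def field_simps)
    qed (use e(1) cW[OF eW] in \<open>simp_all add: e'_def\<close>)
  qed
  moreover have "span (e' ` {..<Suc k}) = V"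
  proof
    have cV: "c \<in> V" unfolding c_def
      using b B(1) WV orth_proj(1)[OF W, of b] by (intro subspace_diff[OF V(1)]) auto
    then show "span (e' ` {..<Suc k}) \<subseteq> V"
      using eW WV by (intro span_minimal V(1)) (auto simp: e'_def less_Suc_eq intro: subspace_scale[OF V(1)])
    have "e ` {..<k} \<subseteq> e' ` {..<Suc k}" by (force simp: e'_def)
    then have W': "W \<subseteq> span (e' ` {..<Suc k})" unfolding e(2)[symmetric] by (rule span_mono)
    have "e' k \<in> span (e' ` {..<Suc k})" by (intro span_base) auto
    then have "norm c *\<^sub>R e' k + orth_proj W b \<in> span (e' ` {..<Suc k})"
      using W' orth_proj(1)[OF W, of b] by (intro span_add span_scale) auto
    moreover have "norm c *\<^sub>R e' k + orth_proj W b = b" using c by (simp add: e'_def c_def)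
    ultimately have "b \<in> span (e' ` {..<Suc k})" by simp
    moreover have "B - {b} \<subseteq> W" by (auto simp: W_def intro: span_base)
    ultimately have "B \<subseteq> span (e' ` {..<Suc k})" using W' by blast
    then show "V \<subseteq> span (e' ` {..<Suc k})"
      using B(3) span_minimal[OF _ subspace_span] by blast
  qed
  ultimately show ?case by blast
qed

lemma orth_proj_eq_self:
  assumes "V \<in> grassmannian n k" "x \<in> V"
  shows "orth_proj V x = x"
  using assms by (intro orth_proj_eqI) (auto simp: orthogonal_def)

lemma norm_orth_proj_le:
  assumes "V \<in> grassmannian n k"
  shows "norm (orth_proj V x) \<le> norm x"
proof -
  let ?p = "orth_proj V x"
  have "orthogonal (x - ?p) ?p" using orth_proj[OF assms] by blast
  then have "(norm ((x - ?p) + ?p))\<^sup>2 = (norm (x - ?p))\<^sup>2 + (norm ?p)\<^sup>2"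
    by (rule norm_add_Pythagorean)
  then have "(norm ?p)\<^sup>2 \<le> (norm x)\<^sup>2" by simp
  then show ?thesis by (rule power2_le_imp_le) simp
qed

lemma bounded_orth_proj:
  assumes "V \<in> grassmannian n k" "bounded A"
  shows "bounded (orth_proj V ` A)"
proof -
  obtain B where "\<And>x. x \<in> A \<Longrightarrow> norm x \<le> B" using assms(2) unfolding bounded_iff by blast
  then have "norm y \<le> B" if "y \<in> orth_proj V ` A" for y
    using that norm_orth_proj_le[OF assms(1)] order.trans by blast
  then show ?thesis unfolding bounded_iff by blast
qed

text \<open>
  An isometric identification of a \<open>k\<close>-dimensional subspace \<open>V\<close> with \<open>\<real>\<^sup>k\<close>.  The map \<open>\<psi>\<close> is
  defined on the whole space and gives the coordinates of the projection onto \<open>V\<close>, so that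
  projecting to \<open>V\<close> amounts to applying \<open>\<psi>\<close>.
\<close>

locale grassmannian_chart =
  fixes n k :: nat and V :: "fseq set" and \<phi> \<psi> :: "fseq \<Rightarrow> fseq"
  assumes V: "V \<in> grassmannian n k"
    and linear_\<phi>: "linear \<phi>"
    and linear_\<psi>: "linear \<psi>"
    and \<phi>_in_V: "\<phi> y \<in> V"
    and \<psi>_in_Rn: "\<psi> x \<in> Rn k"
    and norm_\<phi>: "y \<in> Rn k \<Longrightarrow> norm (\<phi> y) = norm y"
    and \<psi>_\<phi>: "y \<in> Rn k \<Longrightarrow> \<psi> (\<phi> y) = y"
    and orth_proj_eq: "orth_proj V x = \<phi> (\<psi> x)"
begin

lemma \<phi>_\<psi>: "x \<in> V \<Longrightarrow> \<phi> (\<psi> x) = x"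
  using orth_proj_eq_self[OF V] by (simp add: orth_proj_eq)

lemma norm_\<psi>: "x \<in> V \<Longrightarrow> norm (\<psi> x) = norm x"
  using norm_\<phi>[OF \<psi>_in_Rn, of x] by (simp add: \<phi>_\<psi>)

lemma dist_\<phi>: "x \<in> Rn k \<Longrightarrow> y \<in> Rn k \<Longrightarrow> dist (\<phi> x) (\<phi> y) = dist x y"
  using norm_\<phi>[of "x - y"] by (simp add: dist_norm subspace_diff[OF subspace_Rn] linear_diff[OF linear_\<phi>])

lemma dist_\<psi>: "x \<in> V \<Longrightarrow> y \<in> V \<Longrightarrow> dist (\<psi> x) (\<psi> y) = dist x y"
  using V norm_\<psi>[of "x - y"]
  by (simp add: dist_norm subspace_diff linear_diff[OF linear_\<psi>] grassmannian_def)

lemma \<psi>_orth_proj: "\<psi> (orth_proj V x) = \<psi> x"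
  by (simp add: orth_proj_eq \<psi>_\<phi> \<psi>_in_Rn)

end

lemma grassmannian_chart_exists:
  assumes V: "V \<in> grassmannian n k"
  obtains \<phi> \<psi> where "grassmannian_chart n k V \<phi> \<psi>"
proof -
  obtain e where e: "\<And>i j. i < k \<Longrightarrow> j < k \<Longrightarrow> inner (e i) (e j) = (if i = j then 1 else 0)"
      "span (e ` {..<k}) = V"
    using grassmannian_orthonormal_frame[OF V] by blast
  define \<phi> where "\<phi> y = (\<Sum>i<k. coord y i *\<^sub>R e i)" for y
  define \<psi> where "\<psi> x = (\<Sum>i<k. inner x (e i) *\<^sub>R unit_vec i)" for x
  have \<phi>e: "inner (\<phi> y) (e j) = coord y j" if "j < k" for y j
  proof -
    have "inner (\<phi> y) (e j) = (\<Sum>i<k. coord y i * (if i = j then 1 else 0))"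
      unfolding \<phi>_def inner_sum_left by (intro sum.cong) (use that e(1) in auto)
    then show ?thesis using that by (simp add: if_distrib cong: if_cong)
  qed
  have \<phi>V: "\<phi> y \<in> V" for y
    unfolding \<phi>_def e(2)[symmetric] by (intro span_sum span_scale span_base) auto
  have "grassmannian_chart n k V \<phi> \<psi>"
  proof (rule grassmannian_chart.intro)
    show "V \<in> grassmannian n k" by (rule V)
    show "linear \<phi>" by (rule linearI) (simp_all add: \<phi>_def algebra_simps sum.distrib scaleR_right.sum)
    show "linear \<psi>" by (rule linearI) (simp_all add: \<psi>_def algebra_simps sum.distrib scaleR_right.sum)
    show "\<psi> x \<in> Rn k" for x unfolding \<psi>_def by (rule sum_unit_vec_in_Rn)
    show "\<phi> y \<in> V" for y by (rule \<phi>V)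
    fix y assume y: "y \<in> Rn k"
    show "norm (\<phi> y) = norm y"
    proof -
      have "inner (\<phi> y) (\<phi> y) = (\<Sum>i<k. coord y i * inner (\<phi> y) (e i))"
        by (subst (2) \<phi>_def) (simp add: inner_sum_right)
      also have "\<dots> = (\<Sum>i<k. (coord y i)\<^sup>2)" by (simp add: \<phi>e power2_eq_square)
      finally show ?thesis unfolding norm_Rn[OF y] by (subst norm_eq_sqrt_inner) simp
    qed
    show "\<psi> (\<phi> y) = y" using Rn_expansion[OF y] by (simp add: \<psi>_def \<phi>e)
  next
    fix x
    show "orth_proj V x = \<phi> (\<psi> x)"
    proof (rule orth_proj_eqI[OF V \<phi>V])
      fix v assume "v \<in> V"
      then have v: "v \<in> span (e ` {..<k})" by (simp add: e(2))
      have res: "inner (x - \<phi> (\<psi> x)) (e j) = 0" if "j < k" for j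
        using that by (simp add: inner_diff_left \<phi>e \<psi>_def coord_sum_unit_vec)
      show "orthogonal (x - \<phi> (\<psi> x)) v"
        by (rule orthogonal_to_span[OF v]) (use res in \<open>auto simp: orthogonal_def\<close>)
    qed
  qed
  then show thesis by (rule that)
qed

lemma hausdorff_dim_grassmannian_le:
  assumes V: "V \<in> grassmannian n k" and A: "A \<subseteq> V" "bounded A"
  shows "hausdorff_dim A \<le> ereal (real k)"
proof -
  obtain \<phi> \<psi> where "grassmannian_chart n k V \<phi> \<psi>" using V by (rule grassmannian_chart_exists)
  then interpret grassmannian_chart n k V \<phi> \<psi> .
  have "\<phi> ` \<psi> ` A = A" using \<phi>_\<psi> A(1) by (force simp: image_image)
  then have "hausdorff_dim A = hausdorff_dim (\<phi> ` \<psi> ` A)" by simp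
  also have "\<dots> \<le> hausdorff_dim (\<psi> ` A)"
    by (rule hausdorff_dim_lipschitz[where L = 1]) (auto simp: dist_\<phi> \<psi>_in_Rn)
  also have "\<dots> \<le> ereal (real k)"
  proof (rule hausdorff_dim_Rn_le)
    show "\<psi> ` A \<subseteq> Rn k" using \<psi>_in_Rn by auto
    show "bounded (\<psi> ` A)" using A norm_\<psi> by (auto simp: bounded_iff subset_iff)
  qed
  finally show ?thesis .
qed

lemma hausdorff_dim_grassmannian_ge:
  assumes V: "V \<in> grassmannian n k" and "k > 0" "r > 0" "a \<in> V" and A: "ball a r \<inter> V \<subseteq> A"
  shows "hausdorff_dim A \<ge> ereal (real k)"
proof -
  obtain \<phi> \<psi> where "grassmannian_chart n k V \<phi> \<psi>" using V by (rule grassmannian_chart_exists)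
  then interpret grassmannian_chart n k V \<phi> \<psi> .
  have "ball (\<psi> a) r \<inter> Rn k \<subseteq> \<psi> ` (ball a r \<inter> V)"
  proof
    fix y assume y: "y \<in> ball (\<psi> a) r \<inter> Rn k"
    then have "dist a (\<phi> y) < r"
      using dist_\<phi>[OF \<psi>_in_Rn, of y a] \<phi>_\<psi>[OF assms(4)] by simp
    then have "\<phi> y \<in> ball a r \<inter> V" using \<phi>_in_V by simp
    then show "y \<in> \<psi> ` (ball a r \<inter> V)" using \<psi>_\<phi>[of y] y by (metis IntD2 imageI)
  qed
  then have "ereal (real k) \<le> hausdorff_dim (\<psi> ` (ball a r \<inter> V))"
    using assms \<psi>_in_Rn by (intro hausdorff_dim_Rn_ge[of k r "\<psi> a"]) auto
  also have "\<dots> \<le> hausdorff_dim (ball a r \<inter> V)"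
    by (rule hausdorff_dim_lipschitz[where L = 1]) (auto simp: dist_\<psi>)
  also have "\<dots> \<le> hausdorff_dim A" using A by (rule hausdorff_dim_mono)
  finally show ?thesis .
qed

section \<open>Directions, segments and Kakeya sets\<close>

lemma unit_sphere_iff: "\<theta> \<in> unit_sphere n \<longleftrightarrow> norm \<theta> = 1 \<and> \<theta> \<in> Rn n"
  by (auto simp: unit_sphere_def)

lemma unit_segment_iff: "x \<in> unit_segment a \<theta> \<longleftrightarrow> (\<exists>t. \<bar>t\<bar> \<le> 1/2 \<and> x = a + t *\<^sub>R \<theta>)"
proof
  assume "x \<in> unit_segment a \<theta>"
  then obtain u where u: "0 \<le> u" "u \<le> 1" "x = (1 - u) *\<^sub>R (a - (1/2) *\<^sub>R \<theta>) + u *\<^sub>R (a + (1/2) *\<^sub>R \<theta>)"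
    by (auto simp: unit_segment_def closed_segment_def)
  have "\<bar>u - 1/2\<bar> \<le> 1/2" using u(1,2) by linarith
  moreover have "x = a + (u - 1/2) *\<^sub>R \<theta>"
    unfolding u(3) by (rule fseq_eqI) (simp add: field_simps)
  ultimately show "\<exists>t. \<bar>t\<bar> \<le> 1/2 \<and> x = a + t *\<^sub>R \<theta>" by blast
next
  assume "\<exists>t. \<bar>t\<bar> \<le> 1/2 \<and> x = a + t *\<^sub>R \<theta>"
  then obtain t where t: "\<bar>t\<bar> \<le> 1/2" "x = a + t *\<^sub>R \<theta>" by blast
  have "x = (1 - (t + 1/2)) *\<^sub>R (a - (1/2) *\<^sub>R \<theta>) + (t + 1/2) *\<^sub>R (a + (1/2) *\<^sub>R \<theta>)"
    unfolding t(2) by (rule fseq_eqI) (simp add: field_simps)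
  moreover have "0 \<le> t + 1/2" "t + 1/2 \<le> 1" using t(1) by (auto simp: abs_le_iff)
  ultimately show "x \<in> unit_segment a \<theta>"
    unfolding unit_segment_def closed_segment_def by blast
qed

lemma center_in_unit_segment: "a \<in> unit_segment a \<theta>"
  unfolding unit_segment_iff by (rule exI[of _ 0]) simp

lemma interior_of_unit_sphere_nonempty_iff:
  assumes "\<Omega> \<subseteq> unit_sphere n"
  shows "top_of_set (unit_sphere n) interior_of \<Omega> \<noteq> {} \<longleftrightarrow>
    (\<exists>\<theta>\<^sub>0\<in>unit_sphere n. \<exists>\<epsilon>>0. unit_sphere n \<inter> ball \<theta>\<^sub>0 \<epsilon> \<subseteq> \<Omega>)"
proof
  assume "top_of_set (unit_sphere n) interior_of \<Omega> \<noteq> {}"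
  then obtain T \<theta>\<^sub>0 where "openin (top_of_set (unit_sphere n)) T" "\<theta>\<^sub>0 \<in> T" "T \<subseteq> \<Omega>"
    by (auto simp: interior_of_def)
  then show "\<exists>\<theta>\<^sub>0\<in>unit_sphere n. \<exists>\<epsilon>>0. unit_sphere n \<inter> ball \<theta>\<^sub>0 \<epsilon> \<subseteq> \<Omega>"
    unfolding openin_contains_ball by (metis Int_commute subset_iff)
next
  assume "\<exists>\<theta>\<^sub>0\<in>unit_sphere n. \<exists>\<epsilon>>0. unit_sphere n \<inter> ball \<theta>\<^sub>0 \<epsilon> \<subseteq> \<Omega>"
  then obtain \<theta>\<^sub>0 \<epsilon> where *: "\<theta>\<^sub>0 \<in> unit_sphere n" "\<epsilon> > 0" "unit_sphere n \<inter> ball \<theta>\<^sub>0 \<epsilon> \<subseteq> \<Omega>" by blast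
  have "openin (top_of_set (unit_sphere n)) (unit_sphere n \<inter> ball \<theta>\<^sub>0 \<epsilon>)"
    by (intro openin_open_Int) simp
  moreover have "\<theta>\<^sub>0 \<in> unit_sphere n \<inter> ball \<theta>\<^sub>0 \<epsilon>" using * by simp
  ultimately have "\<theta>\<^sub>0 \<in> top_of_set (unit_sphere n) interior_of \<Omega>"
    using *(3) unfolding interior_of_def by blast
  then show "top_of_set (unit_sphere n) interior_of \<Omega> \<noteq> {}" by blast
qed

lemma kakeya_setI:
  assumes "\<Omega> \<subseteq> unit_sphere n" "\<theta>\<^sub>0 \<in> unit_sphere n" "\<epsilon> > 0" "unit_sphere n \<inter> ball \<theta>\<^sub>0 \<epsilon> \<subseteq> \<Omega>"
    and "\<And>\<theta>. \<theta> \<in> \<Omega> \<Longrightarrow> a \<theta> \<in> Rn n" "bounded (\<Union>\<theta>\<in>\<Omega>. unit_segment (a \<theta>) \<theta>)"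
  shows "kakeya_set n (\<Union>\<theta>\<in>\<Omega>. unit_segment (a \<theta>) \<theta>)"
  unfolding kakeya_set_def directed_kakeya_set_def
  using assms interior_of_unit_sphere_nonempty_iff[OF assms(1)] by blast

lemma kakeya_setE:
  assumes "kakeya_set n K"
  obtains \<Omega> \<theta>\<^sub>0 \<epsilon> a where "\<Omega> \<subseteq> unit_sphere n" "\<theta>\<^sub>0 \<in> unit_sphere n" "\<epsilon> > 0"
    "unit_sphere n \<inter> ball \<theta>\<^sub>0 \<epsilon> \<subseteq> \<Omega>" "\<And>\<theta>. \<theta> \<in> \<Omega> \<Longrightarrow> a \<theta> \<in> Rn n"
    "K = (\<Union>\<theta>\<in>\<Omega>. unit_segment (a \<theta>) \<theta>)"
proof -
  obtain \<Omega> a where \<Omega>: "\<Omega> \<subseteq> unit_sphere n" "top_of_set (unit_sphere n) interior_of \<Omega> \<noteq> {}"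
      "\<forall>\<theta>\<in>\<Omega>. a \<theta> \<in> Rn n" "K = (\<Union>\<theta>\<in>\<Omega>. unit_segment (a \<theta>) \<theta>)"
    using assms unfolding kakeya_set_def directed_kakeya_set_def by blast
  moreover obtain \<theta>\<^sub>0 \<epsilon> where "\<theta>\<^sub>0 \<in> unit_sphere n" "\<epsilon> > 0" "unit_sphere n \<inter> ball \<theta>\<^sub>0 \<epsilon> \<subseteq> \<Omega>"
    using interior_of_unit_sphere_nonempty_iff[OF \<Omega>(1)] \<Omega>(2) by blast
  ultimately show thesis by (intro that[of \<Omega> \<theta>\<^sub>0 \<epsilon> a]) auto
qed

lemma kakeya_set_bounded: "kakeya_set n K \<Longrightarrow> bounded K"
  by (auto simp: kakeya_set_def directed_kakeya_set_def)

lemma kakeya_set_subset_Rn: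
  assumes "kakeya_set n K"
  shows "K \<subseteq> Rn n"
proof -
  obtain \<Omega> \<theta>\<^sub>0 \<epsilon> a where \<Omega>: "\<Omega> \<subseteq> unit_sphere n" "\<theta>\<^sub>0 \<in> unit_sphere n" "\<epsilon> > 0"
    "unit_sphere n \<inter> ball \<theta>\<^sub>0 \<epsilon> \<subseteq> \<Omega>" "\<And>\<theta>. \<theta> \<in> \<Omega> \<Longrightarrow> a \<theta> \<in> Rn n"
    "K = (\<Union>\<theta>\<in>\<Omega>. unit_segment (a \<theta>) \<theta>)"
    using assms by (rule kakeya_setE) (rule that)
  show ?thesis
  proof
    fix x assume "x \<in> K"
    then obtain \<theta> t where "\<theta> \<in> \<Omega>" "x = a \<theta> + t *\<^sub>R \<theta>" by (auto simp: \<Omega>(6) unit_segment_iff)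
    moreover have "\<theta> \<in> Rn n" using \<Omega>(1) \<open>\<theta> \<in> \<Omega>\<close> by (auto simp: unit_sphere_iff)
    ultimately show "x \<in> Rn n" using \<Omega>(5) by (simp add: subspace_add subspace_scale subspace_Rn)
  qed
qed

text \<open>
  The base case not covered by the Kakeya conjecture, which starts in dimension 2: a single unit
  segment of the line already contains an interval.
\<close>

lemma hausdorff_dim_kakeya_set_1:
  assumes "kakeya_set 1 K"
  shows "hausdorff_dim K \<ge> 1"
proof -
  obtain \<Omega> \<theta>\<^sub>0 \<epsilon> a where \<Omega>: "\<Omega> \<subseteq> unit_sphere 1" "\<theta>\<^sub>0 \<in> unit_sphere 1" "\<epsilon> > 0"
    "unit_sphere 1 \<inter> ball \<theta>\<^sub>0 \<epsilon> \<subseteq> \<Omega>" "\<And>\<theta>. \<theta> \<in> \<Omega> \<Longrightarrow> a \<theta> \<in> Rn 1"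
    "K = (\<Union>\<theta>\<in>\<Omega>. unit_segment (a \<theta>) \<theta>)"
    using assms by (rule kakeya_setE) (rule that)
  have \<theta>0: "\<theta>\<^sub>0 \<in> \<Omega>" using \<Omega> by auto
  have \<theta>1: "\<theta>\<^sub>0 \<in> Rn 1" "norm \<theta>\<^sub>0 = 1" using \<Omega>(2) by (auto simp: unit_sphere_iff)
  then have abs1: "\<bar>coord \<theta>\<^sub>0 0\<bar> = 1" using norm_Rn[of \<theta>\<^sub>0 1] by simp
  then have c1: "(coord \<theta>\<^sub>0 0)\<^sup>2 = 1" by (metis power2_abs power_one)
  have "ball (a \<theta>\<^sub>0) (1/2) \<inter> Rn 1 \<subseteq> K"
  proof
    fix x assume x: "x \<in> ball (a \<theta>\<^sub>0) (1/2) \<inter> Rn 1"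
    define t where "t = coord (x - a \<theta>\<^sub>0) 0 * coord \<theta>\<^sub>0 0"
    have "\<bar>t\<bar> \<le> 1/2"
      using abs1 abs_coord_le_norm[of "x - a \<theta>\<^sub>0" 0] x
      by (simp add: t_def abs_mult dist_norm norm_minus_commute)
    moreover have "x = a \<theta>\<^sub>0 + t *\<^sub>R \<theta>\<^sub>0"
    proof (rule fseq_eqI)
      fix i
      show "coord x i = coord (a \<theta>\<^sub>0 + t *\<^sub>R \<theta>\<^sub>0) i"
      proof (cases "i = 0")
        case True
        have "t * coord \<theta>\<^sub>0 0 = coord (x - a \<theta>\<^sub>0) 0 * (coord \<theta>\<^sub>0 0)\<^sup>2"
          by (simp add: t_def power2_eq_square)
        then show ?thesis using True c1 by simp
      next
        case False
        then show ?thesis using x \<theta>1 \<Omega>(5)[OF \<theta>0] by (simp add: Rn_def)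
      qed
    qed
    ultimately have "x \<in> unit_segment (a \<theta>\<^sub>0) \<theta>\<^sub>0" unfolding unit_segment_iff by blast
    then show "x \<in> K" unfolding \<Omega>(6) using \<theta>0 by blast
  qed
  then have "ereal (real 1) \<le> hausdorff_dim K"
    using \<Omega>(5)[OF \<theta>0] by (intro hausdorff_dim_Rn_ge[of 1 "1/2" "a \<theta>\<^sub>0"]) auto
  then show ?thesis by (simp add: one_ereal_def)
qed

section \<open>Kakeya sets inside projections of Kakeya sets\<close>

context grassmannian_chart
begin

lemma norm_\<psi>_le: "norm (\<psi> x) \<le> norm x"
  using norm_orth_proj_le[OF V, of x] norm_\<phi>[OF \<psi>_in_Rn, of x] by (simp add: orth_proj_eq)

lemma inner_residual: "inner (x - \<phi> (\<psi> x)) (\<phi> y) = 0"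
  using orth_proj(2)[OF V \<phi>_in_V, of x y] by (simp add: orthogonal_def orth_proj_eq)

text \<open>
  The projections of the segments in directions orthogonal to \<open>V\<close> degenerate to points.
  Tilting such a direction slightly towards a unit vector of \<open>V\<close> cures this.
\<close>

lemma exists_direction_not_orthogonal:
  assumes "0 < k" "\<theta>\<^sub>0 \<in> unit_sphere n" "\<epsilon> > 0"
  obtains \<theta> where "\<theta> \<in> unit_sphere n" "dist \<theta>\<^sub>0 \<theta> < \<epsilon>" "\<psi> \<theta> \<noteq> 0"
proof (cases "\<psi> \<theta>\<^sub>0 = 0")
  case False
  then show thesis using assms by (intro that[of \<theta>\<^sub>0]) auto
next
  case True
  define e where "e = \<phi> (unit_vec 0)"
  have u0: "unit_vec 0 \<in> Rn k" using assms(1) by (simp add: Rn_def unit_vec.rep_eq)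
  have e: "norm e = 1" "\<psi> e = unit_vec 0" by (simp_all add: e_def norm_\<phi> \<psi>_\<phi> u0)
  have eR: "e \<in> Rn n" using \<phi>_in_V V by (auto simp: e_def grassmannian_def)
  have \<theta>0: "norm \<theta>\<^sub>0 = 1" "\<theta>\<^sub>0 \<in> Rn n" using assms(2) by (auto simp: unit_sphere_iff)
  have orth: "orthogonal \<theta>\<^sub>0 e"
    using inner_residual[of \<theta>\<^sub>0 "unit_vec 0"] True linear_0[OF linear_\<phi>] by (simp add: e_def orthogonal_def)
  \<comment> \<open>The tilted vector \<open>sqrt (1 - t\<^sup>2) \<theta>\<^sub>0 + t e\<close> lies within \<open>2 t\<close> of \<open>\<theta>\<^sub>0\<close>.\<close>
  define t where "t = min (1/2) (\<epsilon> / 4)"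
  have t: "0 < t" "t < 1" "2 * t < \<epsilon>" using assms(3) by (auto simp: t_def min_def)
  have t2: "t\<^sup>2 \<le> t" using t by (simp add: power2_eq_square mult_left_le)
  define s where "s = sqrt (1 - t\<^sup>2)"
  have s: "s\<^sup>2 = 1 - t\<^sup>2" "0 \<le> s" "s \<le> 1" using t2 t by (auto simp: s_def)
  have "s\<^sup>2 \<le> s" using s(2,3) by (simp add: power2_eq_square mult_left_le)
  then have st: "1 - s \<le> t" using s t2 by linarith
  define \<theta> where "\<theta> = s *\<^sub>R \<theta>\<^sub>0 + t *\<^sub>R e"
  show thesis
  proof (rule that[of \<theta>])
    have "(norm \<theta>)\<^sup>2 = s\<^sup>2 + t\<^sup>2"
      unfolding \<theta>_def using orth
      by (subst norm_add_Pythagorean) (auto simp: orthogonal_clauses e \<theta>0 power2_eq_square)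
    then have "(norm \<theta>)\<^sup>2 = 1\<^sup>2" using s by simp
    then have "norm \<theta> = 1" by (rule power2_eq_imp_eq) auto
    then show "\<theta> \<in> unit_sphere n"
      by (simp add: unit_sphere_iff \<theta>_def \<theta>0 eR subspace_add subspace_scale subspace_Rn)
    have "\<theta>\<^sub>0 - \<theta> = (1 - s) *\<^sub>R \<theta>\<^sub>0 + (- t) *\<^sub>R e" by (simp add: \<theta>_def algebra_simps)
    then have "norm (\<theta>\<^sub>0 - \<theta>) \<le> norm ((1 - s) *\<^sub>R \<theta>\<^sub>0) + norm ((- t) *\<^sub>R e)"
      by (metis norm_triangle_ineq)
    then show "dist \<theta>\<^sub>0 \<theta> < \<epsilon>" using t st s by (simp add: dist_norm e \<theta>0)
    have "\<psi> \<theta> = t *\<^sub>R unit_vec 0"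
      by (simp add: \<theta>_def linear_add[OF linear_\<psi>] linear_scale[OF linear_\<psi>] True e)
    then show "\<psi> \<theta> \<noteq> 0" using t norm_unit_vec[of 0] by (metis norm_eq_zero less_irrefl scaleR_eq_0_iff zero_neq_one)
  qed
qed

text \<open>
  Keep the component \<open>w\<close> of \<open>\<theta>\<^sub>1\<close> orthogonal to \<open>V\<close> and turn only its component in \<open>V\<close>, of length \<open>l\<close>.
  This places a copy of \<open>S\<^sup>k\<^sup>-\<^sup>1\<close> through \<open>\<theta>\<^sub>1\<close> inside \<open>S\<^sup>n\<^sup>-\<^sup>1\<close>, all of whose points project to vectors of the
  same length \<open>l\<close>; a segment in direction \<open>\<tau> \<eta>\<close> thus projects to one of length \<open>l\<close> in direction \<open>\<eta>\<close>.
\<close>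

lemma unit_sphere_slice:
  assumes "\<theta>\<^sub>1 \<in> unit_sphere n" "\<psi> \<theta>\<^sub>1 \<noteq> 0"
  obtains \<eta>\<^sub>1 \<tau> l where "\<eta>\<^sub>1 \<in> unit_sphere k" "0 < l"
    "\<And>\<eta>. \<eta> \<in> unit_sphere k \<Longrightarrow> \<tau> \<eta> \<in> unit_sphere n"
    "\<And>\<eta>. \<eta> \<in> unit_sphere k \<Longrightarrow> \<psi> (\<tau> \<eta>) = l *\<^sub>R \<eta>"
    "\<And>\<eta>. \<eta> \<in> unit_sphere k \<Longrightarrow> dist \<theta>\<^sub>1 (\<tau> \<eta>) \<le> dist \<eta>\<^sub>1 \<eta>"
proof -
  define l where "l = norm (\<psi> \<theta>\<^sub>1)"
  define \<eta>\<^sub>1 where "\<eta>\<^sub>1 = \<psi> \<theta>\<^sub>1 /\<^sub>R l"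
  define w where "w = \<theta>\<^sub>1 - \<phi> (\<psi> \<theta>\<^sub>1)"
  define \<tau> where "\<tau> \<eta> = w + l *\<^sub>R \<phi> \<eta>" for \<eta>
  have \<theta>1: "norm \<theta>\<^sub>1 = 1" "\<theta>\<^sub>1 \<in> Rn n" using assms(1) by (auto simp: unit_sphere_iff)
  have l: "0 < l" "l \<le> 1" using assms norm_\<psi>_le[of \<theta>\<^sub>1] \<theta>1 by (auto simp: l_def)
  have VR: "V \<subseteq> Rn n" using V by (simp add: grassmannian_def)
  have \<psi>\<theta>1: "\<psi> \<theta>\<^sub>1 = l *\<^sub>R \<eta>\<^sub>1" using l by (simp add: \<eta>\<^sub>1_def)
  have \<eta>1: "\<eta>\<^sub>1 \<in> unit_sphere k"
    using l \<psi>_in_Rn by (simp add: unit_sphere_iff \<eta>\<^sub>1_def subspace_scale[OF subspace_Rn]) (simp add: l_def)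
  have \<tau>1: "\<tau> \<eta>\<^sub>1 = \<theta>\<^sub>1" by (simp add: \<tau>_def w_def \<psi>\<theta>1 linear_scale[OF linear_\<phi>])
  have norm\<tau>: "(norm (\<tau> \<eta>))\<^sup>2 = (norm w)\<^sup>2 + l\<^sup>2" if "\<eta> \<in> unit_sphere k" for \<eta>
  proof -
    have "orthogonal w (l *\<^sub>R \<phi> \<eta>)" using inner_residual by (simp add: w_def orthogonal_def)
    then show ?thesis unfolding \<tau>_def using that l
      by (subst norm_add_Pythagorean) (simp_all add: unit_sphere_iff norm_\<phi>)
  qed
  have w0: "\<psi> w = 0" by (simp add: w_def linear_diff[OF linear_\<psi>] \<psi>_\<phi> \<psi>_in_Rn)
  show thesis
  proof (rule that[of \<eta>\<^sub>1 l \<tau>])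
    fix \<eta> assume \<eta>: "\<eta> \<in> unit_sphere k"
    have "(norm (\<tau> \<eta>))\<^sup>2 = 1\<^sup>2" using norm\<tau>[OF \<eta>] norm\<tau>[OF \<eta>1] \<theta>1 by (simp add: \<tau>1)
    then have "norm (\<tau> \<eta>) = 1" by (rule power2_eq_imp_eq) auto
    moreover have "\<tau> \<eta> \<in> Rn n"
      using VR \<phi>_in_V \<theta>1 unfolding \<tau>_def w_def
      by (intro subspace_add subspace_diff subspace_scale subspace_Rn) auto
    ultimately show "\<tau> \<eta> \<in> unit_sphere n" by (simp add: unit_sphere_iff)
    have \<eta>R: "\<eta> \<in> Rn k" "\<eta>\<^sub>1 \<in> Rn k" using \<eta> \<eta>1 by (auto simp: unit_sphere_iff)
    then show "\<psi> (\<tau> \<eta>) = l *\<^sub>R \<eta>"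
      by (simp add: \<tau>_def linear_add[OF linear_\<psi>] linear_scale[OF linear_\<psi>] w0 \<psi>_\<phi>)
    have "dist \<theta>\<^sub>1 (\<tau> \<eta>) = norm (l *\<^sub>R (\<phi> \<eta>\<^sub>1 - \<phi> \<eta>))"
      unfolding \<tau>1[symmetric] by (simp add: \<tau>_def dist_norm scaleR_diff_right)
    also have "\<dots> = l * dist \<eta>\<^sub>1 \<eta>" using l dist_\<phi>[OF \<eta>R(2,1)] by (simp add: dist_norm)
    also have "\<dots> \<le> dist \<eta>\<^sub>1 \<eta>" using l by (simp add: mult_left_le_one_le)
    finally show "dist \<theta>\<^sub>1 (\<tau> \<eta>) \<le> dist \<eta>\<^sub>1 \<eta>" .
  qed (use \<eta>1 l in auto)
qed

end

text \<open>
  Projecting the segments whose directions lie in such a slice and rescaling by \<open>1/l\<close> yields unit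
  segments in an open set of directions of \<open>\<real>\<^sup>k\<close>.
\<close>

lemma kakeya_set_in_projection:
  assumes K: "kakeya_set n K" and V: "V \<in> grassmannian n k" and "0 < k"
  obtains K' where "kakeya_set k K'" "hausdorff_dim K' \<le> hausdorff_dim (orth_proj V ` K)"
proof -
  obtain \<phi> \<psi> where "grassmannian_chart n k V \<phi> \<psi>" using V by (rule grassmannian_chart_exists)
  then interpret grassmannian_chart n k V \<phi> \<psi> .
  obtain \<Omega> \<theta>\<^sub>0 \<epsilon> a where \<Omega>: "\<Omega> \<subseteq> unit_sphere n" "\<theta>\<^sub>0 \<in> unit_sphere n" "\<epsilon> > 0"
    "unit_sphere n \<inter> ball \<theta>\<^sub>0 \<epsilon> \<subseteq> \<Omega>" "\<And>\<theta>. \<theta> \<in> \<Omega> \<Longrightarrow> a \<theta> \<in> Rn n"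
    "K = (\<Union>\<theta>\<in>\<Omega>. unit_segment (a \<theta>) \<theta>)"
    using K by (rule kakeya_setE) (rule that)
  obtain \<theta>\<^sub>1 where \<theta>1: "\<theta>\<^sub>1 \<in> unit_sphere n" "dist \<theta>\<^sub>0 \<theta>\<^sub>1 < \<epsilon>" "\<psi> \<theta>\<^sub>1 \<noteq> 0"
    using assms(3) \<Omega>(2,3) by (rule exists_direction_not_orthogonal)
  obtain \<eta>\<^sub>1 \<tau> l where \<tau>: "\<eta>\<^sub>1 \<in> unit_sphere k" "0 < l"
    "\<And>\<eta>. \<eta> \<in> unit_sphere k \<Longrightarrow> \<tau> \<eta> \<in> unit_sphere n"
    "\<And>\<eta>. \<eta> \<in> unit_sphere k \<Longrightarrow> \<psi> (\<tau> \<eta>) = l *\<^sub>R \<eta>"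
    "\<And>\<eta>. \<eta> \<in> unit_sphere k \<Longrightarrow> dist \<theta>\<^sub>1 (\<tau> \<eta>) \<le> dist \<eta>\<^sub>1 \<eta>"
    by (rule unit_sphere_slice[OF \<theta>1(1,3)]) (rule that)
  define \<delta> where "\<delta> = \<epsilon> - dist \<theta>\<^sub>0 \<theta>\<^sub>1"
  define \<Omega>' where "\<Omega>' = unit_sphere k \<inter> ball \<eta>\<^sub>1 \<delta>"
  define f where "f x = \<psi> x /\<^sub>R l" for x
  define a' where "a' \<eta> = f (a (\<tau> \<eta>))" for \<eta>
  define K' where "K' = (\<Union>\<eta>\<in>\<Omega>'. unit_segment (a' \<eta>) \<eta>)"
  have \<tau>\<Omega>: "\<tau> \<eta> \<in> \<Omega>" if "\<eta> \<in> \<Omega>'" for \<eta>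
  proof -
    have "dist \<theta>\<^sub>0 (\<tau> \<eta>) < \<epsilon>"
      using \<tau>(5)[of \<eta>] that dist_triangle[of \<theta>\<^sub>0 "\<tau> \<eta>" \<theta>\<^sub>1] by (auto simp: \<Omega>'_def \<delta>_def)
    then show ?thesis using \<Omega>(4) \<tau>(3)[of \<eta>] that by (auto simp: \<Omega>'_def)
  qed
  have sub: "K' \<subseteq> f ` orth_proj V ` K"
  proof
    fix x assume "x \<in> K'"
    then obtain \<eta> t where \<eta>: "\<eta> \<in> \<Omega>'" "\<bar>t\<bar> \<le> 1/2" "x = a' \<eta> + t *\<^sub>R \<eta>"
      by (auto simp: K'_def unit_segment_iff)
    have z: "a (\<tau> \<eta>) + t *\<^sub>R \<tau> \<eta> \<in> K"
      unfolding \<Omega>(6) using \<eta>(2) by (intro UN_I[OF \<tau>\<Omega>[OF \<eta>(1)]]) (unfold unit_segment_iff, blast)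
    have "f (orth_proj V (a (\<tau> \<eta>) + t *\<^sub>R \<tau> \<eta>)) = x"
      using \<eta> \<tau>(2) \<tau>(4)[of \<eta>]
      by (simp add: f_def \<psi>_orth_proj a'_def linear_add[OF linear_\<psi>] linear_scale[OF linear_\<psi>]
          \<Omega>'_def scaleR_add_right)
    then show "x \<in> f ` orth_proj V ` K" using z by blast
  qed
  have f_diff: "f x - f y = f (x - y)" for x y
    by (simp add: f_def linear_diff[OF linear_\<psi>] scaleR_diff_right)
  have norm_f: "norm (f x) \<le> inverse l * norm x" for x
    using \<tau>(2) norm_\<psi>_le[of x] by (simp add: f_def mult_left_mono)
  have "bounded (orth_proj V ` K)" using V kakeya_set_bounded[OF K] by (rule bounded_orth_proj)
  then obtain B where B: "\<And>x. x \<in> orth_proj V ` K \<Longrightarrow> norm x \<le> B" unfolding bounded_iff by blast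
  have "norm (f x) \<le> inverse l * B" if "x \<in> orth_proj V ` K" for x
    using norm_f[of x] B[OF that] \<tau>(2) by (meson inverse_nonnegative_iff_nonnegative less_imp_le mult_left_mono order.trans)
  then have "bounded (f ` orth_proj V ` K)" unfolding bounded_iff by blast
  then have "bounded K'" using sub by (rule bounded_subset)
  then have "kakeya_set k K'"
    unfolding K'_def using \<tau>(1) \<theta>1(2)
    by (intro kakeya_setI[of \<Omega>' k \<eta>\<^sub>1 \<delta>])
      (auto simp: \<Omega>'_def \<delta>_def a'_def f_def subspace_scale[OF subspace_Rn] \<psi>_in_Rn)
  moreover have "hausdorff_dim K' \<le> hausdorff_dim (orth_proj V ` K)"
  proof (rule order.trans[OF hausdorff_dim_mono[OF sub]])
    show "hausdorff_dim (f ` orth_proj V ` K) \<le> hausdorff_dim (orth_proj V ` K)"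
      by (rule hausdorff_dim_lipschitz[where L = "inverse l"]) (simp add: dist_norm f_diff norm_f)
  qed
  ultimately show thesis by (rule that)
qed

section \<open>Splitting \<open>\<real>\<^sup>n\<^sup>+\<^sup>m\<close> into the first \<open>n\<close> and the last \<open>m\<close> coordinates\<close>

lemma independent_unit_vec: "independent (unit_vec ` S)"
proof (rule pairwise_orthogonal_independent)
  show "pairwise orthogonal (unit_vec ` S)"
    by (auto simp: pairwise_def orthogonal_def inner_unit_vec unit_vec.rep_eq)
  show "0 \<notin> unit_vec ` S" using norm_unit_vec by (metis imageE norm_zero zero_neq_one)
qed

lemma inj_unit_vec: "inj unit_vec"
proof
  fix a b assume "unit_vec a = unit_vec b"
  then have "coord (unit_vec a) a = coord (unit_vec b) a" by simp
  then show "a = b" by (simp add: unit_vec.rep_eq split: if_splits)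
qed

lemma Rn_mono: "m \<le> n \<Longrightarrow> Rn m \<subseteq> Rn n"
  by (auto simp: Rn_def)

lemma Rn_in_grassmannian: "Rn n \<in> grassmannian (n + m) n"
  by (simp add: grassmannian_def subspace_Rn dim_Rn Rn_mono)

definition last_coords :: "nat \<Rightarrow> nat \<Rightarrow> fseq set"
  where "last_coords n m = span (unit_vec ` {n..<n + m})"

lemma last_coords_in_grassmannian: "last_coords n m \<in> grassmannian (n + m) m"
proof -
  have "last_coords n m \<subseteq> Rn (n + m)"
    unfolding last_coords_def Rn_eq_span by (intro span_mono image_mono) auto
  moreover have "dim (last_coords n m) = m"
    unfolding last_coords_def dim_span
    by (simp add: dim_eq_card_independent independent_unit_vec card_image inj_on_subset[OF inj_unit_vec])
  ultimately show ?thesis by (simp add: grassmannian_def last_coords_def)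
qed

lemma orthogonal_Rn_last_coords:
  assumes "u \<in> Rn n" "v \<in> last_coords n m"
  shows "orthogonal u v"
  using assms(2) unfolding last_coords_def
  by (rule orthogonal_to_span) (use assms(1) in \<open>auto simp: orthogonal_def inner_unit_vec Rn_def\<close>)

lemma orth_proj_Rn_add:
  assumes "u \<in> Rn n" "v \<in> last_coords n m"
  shows "orth_proj (Rn n) (u + v) = u"
  using assms orthogonal_Rn_last_coords
  by (intro orth_proj_eqI[OF Rn_in_grassmannian[of n m]]) (auto simp: orthogonal_commute)

lemma orth_proj_last_coords_add:
  assumes "u \<in> Rn n" "v \<in> last_coords n m"
  shows "orth_proj (last_coords n m) (u + v) = v"
  using assms orthogonal_Rn_last_coords
  by (intro orth_proj_eqI[OF last_coords_in_grassmannian]) auto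

lemma Rn_add_decomposition:
  assumes "x \<in> Rn (n + m)"
  obtains u v where "u \<in> Rn n" "v \<in> last_coords n m" "x = u + v"
proof
  let ?u = "\<Sum>j<n. coord x j *\<^sub>R unit_vec j" and ?v = "\<Sum>j\<in>{n..<n + m}. coord x j *\<^sub>R unit_vec j"
  show "?u \<in> Rn n" by (rule sum_unit_vec_in_Rn)
  show "?v \<in> last_coords n m"
    unfolding last_coords_def by (intro span_sum span_scale span_base) auto
  show "x = ?u + ?v"
    using assms by (intro fseq_eqI) (auto simp: coord_sum_unit_vec Rn_def)
qed

section \<open>A Kakeya set in higher dimension with one small and one large projection\<close>

text \<open>
  Used for the openness of the set of directions \<open>\<theta>\<close> whose projection, once normalised, lies in a given
  open set.
\<close>

lemma dist_sgn_le:
  fixes x y :: "'a::real_normed_vector"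
  assumes "norm y = 1" "x \<noteq> 0"
  shows "dist y (sgn x) \<le> 2 * dist y x"
proof -
  have "x - sgn x = (norm x - 1) *\<^sub>R sgn x"
    using assms(2) by (simp add: scaleR_diff_left) (simp add: sgn_div_norm)
  then have "dist x (sgn x) = \<bar>norm x - norm y\<bar>"
    using assms by (simp add: dist_norm norm_sgn)
  also have "\<dots> \<le> dist y x" using norm_triangle_ineq3[of x y] by (simp add: dist_norm norm_minus_commute)
  finally show ?thesis using dist_triangle[of y "sgn x" x] by linarith
qed

text \<open>
  The freedom exploited here is that the centres of the segments of a Kakeya set may depend on the
  directions in any bounded way.
  Write a direction as \<open>\<theta> = u + v\<close> along \<open>\<real>\<^sup>n\<^sup>+\<^sup>m = \<real>\<^sup>n \<oplus> W\<close> and put the segment in direction \<open>\<theta>\<close> over the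
  centre of the given segment in direction \<open>u/|u|\<close>, at the height \<open>v\<close>.  As \<open>|u| \<le> 1\<close>, the
  shadow on \<open>\<real>\<^sup>n\<close> stays within that segment, while the centres alone already cover the open unit ball
  of \<open>W\<close>.
\<close>

lemma kakeya_set_extension:
  assumes K: "kakeya_set n K"
  obtains K' where "kakeya_set (n + m) K'" "orth_proj (Rn n) ` K' \<subseteq> K"
    "ball 0 1 \<inter> last_coords n m \<subseteq> orth_proj (last_coords n m) ` K'"
proof -
  obtain \<Omega> \<theta>\<^sub>0 \<epsilon> a where \<Omega>: "\<Omega> \<subseteq> unit_sphere n" "\<theta>\<^sub>0 \<in> unit_sphere n" "\<epsilon> > 0"
    "unit_sphere n \<inter> ball \<theta>\<^sub>0 \<epsilon> \<subseteq> \<Omega>" "\<And>\<theta>. \<theta> \<in> \<Omega> \<Longrightarrow> a \<theta> \<in> Rn n"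
    "K = (\<Union>\<theta>\<in>\<Omega>. unit_segment (a \<theta>) \<theta>)"
    using K by (rule kakeya_setE) (rule that)
  define p where "p = orth_proj (Rn n)"
  define \<Omega>' where "\<Omega>' = {\<theta> \<in> unit_sphere (n + m). p \<theta> \<noteq> 0 \<and> sgn (p \<theta>) \<in> \<Omega>}"
  define a' where "a' \<theta> = a (sgn (p \<theta>)) + (\<theta> - p \<theta>)" for \<theta>
  define K' where "K' = (\<Union>\<theta>\<in>\<Omega>'. unit_segment (a' \<theta>) \<theta>)"
  have W: "subspace (last_coords n m)" by (simp add: last_coords_def)
  have WR: "last_coords n m \<subseteq> Rn (n + m)"
    using last_coords_in_grassmannian by (simp add: grassmannian_def)
  have norm_p: "norm (p x) \<le> norm x" for x
    unfolding p_def by (rule norm_orth_proj_le[OF Rn_in_grassmannian[of n 0]])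
  have split: "p \<theta> \<in> Rn n" "\<theta> - p \<theta> \<in> last_coords n m" if "\<theta> \<in> Rn (n + m)" for \<theta>
  proof -
    obtain u v where uv: "u \<in> Rn n" "v \<in> last_coords n m" "\<theta> = u + v"
      using \<open>\<theta> \<in> Rn (n + m)\<close> by (rule Rn_add_decomposition)
    then have "p \<theta> = u" by (simp add: p_def orth_proj_Rn_add)
    then show "p \<theta> \<in> Rn n" "\<theta> - p \<theta> \<in> last_coords n m" using uv by auto
  qed
  have \<theta>0: "\<theta>\<^sub>0 \<in> Rn n" "norm \<theta>\<^sub>0 = 1" "\<theta>\<^sub>0 \<in> \<Omega>" using \<Omega> by (auto simp: unit_sphere_iff)
  have near: "\<theta> \<in> \<Omega>'" if \<theta>: "\<theta> \<in> unit_sphere (n + m)" "dist \<theta>\<^sub>0 \<theta> < min 1 (\<epsilon> / 2)" for \<theta>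
  proof -
    have \<theta>R: "\<theta> \<in> Rn (n + m)" using \<theta>(1) by (simp add: unit_sphere_iff)
    \<comment> \<open>Neither projecting nor normalising moves \<open>\<theta>\<close> far from \<open>\<theta>\<^sub>0\<close>, which is its own normalised projection.\<close>
    have "p (\<theta>\<^sub>0 - \<theta>) = p ((\<theta>\<^sub>0 - p \<theta>) + - (\<theta> - p \<theta>))" by simp
    also have "\<dots> = \<theta>\<^sub>0 - p \<theta>"
      unfolding p_def using split[OF \<theta>R] \<theta>0(1)
      by (intro orth_proj_Rn_add[where m = m])
        (auto simp: p_def[symmetric] intro: subspace_diff[OF subspace_Rn] subspace_neg[OF W, of "\<theta> - p \<theta>", simplified])
    finally have d: "dist \<theta>\<^sub>0 (p \<theta>) \<le> dist \<theta>\<^sub>0 \<theta>" using norm_p[of "\<theta>\<^sub>0 - \<theta>"] by (simp add: dist_norm)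
    then have p0: "p \<theta> \<noteq> 0" using \<theta>(2) \<theta>0(2) by auto
    then have "dist \<theta>\<^sub>0 (sgn (p \<theta>)) < \<epsilon>"
      using dist_sgn_le[OF \<theta>0(2) p0] d \<theta>(2) by linarith
    moreover have "sgn (p \<theta>) \<in> unit_sphere n"
      using p0 split(1)[OF \<theta>R] by (simp add: unit_sphere_iff norm_sgn) (simp add: sgn_div_norm subspace_scale[OF subspace_Rn])
    ultimately show ?thesis using \<Omega>(4) p0 \<theta>(1) by (auto simp: \<Omega>'_def)
  qed
  have decomp: "a' \<theta> + t *\<^sub>R \<theta> = (a (sgn (p \<theta>)) + t *\<^sub>R p \<theta>) + (1 + t) *\<^sub>R (\<theta> - p \<theta>)" for \<theta> t
    by (simp add: a'_def algebra_simps)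
  have foot: "a (sgn (p \<theta>)) + t *\<^sub>R p \<theta> \<in> K" if "\<theta> \<in> \<Omega>'" "\<bar>t\<bar> \<le> 1/2" for \<theta> t
  proof -
    have "norm (p \<theta>) \<le> 1" using norm_p[of \<theta>] that(1) by (simp add: \<Omega>'_def unit_sphere_iff)
    then have "\<bar>t * norm (p \<theta>)\<bar> \<le> 1/2"
      using that(2) mult_mono[of "\<bar>t\<bar>" "1/2" "norm (p \<theta>)" 1] by (simp add: abs_mult)
    moreover have "t *\<^sub>R p \<theta> = (t * norm (p \<theta>)) *\<^sub>R sgn (p \<theta>)"
      using that(1) by (simp add: sgn_div_norm \<Omega>'_def)
    ultimately show ?thesis using that(1) unfolding \<Omega>(6) \<Omega>'_def by (auto simp: unit_segment_iff)
  qed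
  have tail: "(1 + t) *\<^sub>R (\<theta> - p \<theta>) \<in> last_coords n m" if "\<theta> \<in> \<Omega>'" for \<theta> t
    using that split(2) by (intro subspace_scale[OF W]) (auto simp: \<Omega>'_def unit_sphere_iff)
  obtain B where B: "\<And>x. x \<in> K \<Longrightarrow> norm x \<le> B"
    using kakeya_set_bounded[OF K] unfolding bounded_iff by blast
  have "norm x \<le> B + 3" if "x \<in> K'" for x
  proof -
    obtain \<theta> t where \<theta>: "\<theta> \<in> \<Omega>'" "\<bar>t\<bar> \<le> 1/2" "x = a' \<theta> + t *\<^sub>R \<theta>"
      using \<open>x \<in> K'\<close> by (auto simp: K'_def unit_segment_iff)
    have "norm \<theta> = 1" using \<theta>(1) by (simp add: \<Omega>'_def unit_sphere_iff)
    then have "norm (\<theta> - p \<theta>) \<le> 2" using norm_triangle_ineq4[of \<theta> "p \<theta>"] norm_p[of \<theta>] by linarith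
    then have "\<bar>1 + t\<bar> * norm (\<theta> - p \<theta>) \<le> (3/2) * 2" using \<theta>(2) by (intro mult_mono) auto
    then show ?thesis
      unfolding \<theta>(3) decomp using B[OF foot[OF \<theta>(1,2)]] by (intro norm_triangle_le) simp
  qed
  then have "bounded K'" unfolding bounded_iff by blast
  then have "kakeya_set (n + m) K'"
    unfolding K'_def
  proof (intro kakeya_setI[of \<Omega>' "n + m" \<theta>\<^sub>0 "min 1 (\<epsilon> / 2)"])
    show "\<Omega>' \<subseteq> unit_sphere (n + m)" by (auto simp: \<Omega>'_def)
    show "\<theta>\<^sub>0 \<in> unit_sphere (n + m)" using \<theta>0 Rn_mono[of n "n + m"] by (auto simp: unit_sphere_iff)
    show "min 1 (\<epsilon> / 2) > 0" using \<Omega>(3) by simp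
    show "unit_sphere (n + m) \<inter> ball \<theta>\<^sub>0 (min 1 (\<epsilon> / 2)) \<subseteq> \<Omega>'" using near by auto
    show "a' \<theta> \<in> Rn (n + m)" if "\<theta> \<in> \<Omega>'" for \<theta>
      using that tail[OF that, of 0] \<Omega>(5) WR Rn_mono[of n "n + m"] unfolding a'_def
      by (intro subspace_add[OF subspace_Rn]) (auto simp: \<Omega>'_def)
  qed
  moreover have "orth_proj (Rn n) ` K' \<subseteq> K"
  proof clarify
    fix x assume "x \<in> K'"
    then obtain \<theta> t where \<theta>: "\<theta> \<in> \<Omega>'" "\<bar>t\<bar> \<le> 1/2" "x = a' \<theta> + t *\<^sub>R \<theta>"
      by (auto simp: K'_def unit_segment_iff)
    have "a (sgn (p \<theta>)) + t *\<^sub>R p \<theta> \<in> Rn n" using foot[OF \<theta>(1,2)] kakeya_set_subset_Rn[OF K] by blast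
    then have "orth_proj (Rn n) x = a (sgn (p \<theta>)) + t *\<^sub>R p \<theta>"
      unfolding \<theta>(3) decomp using tail[OF \<theta>(1)] by (rule orth_proj_Rn_add)
    then show "orth_proj (Rn n) x \<in> K" using foot[OF \<theta>(1,2)] by simp
  qed
  moreover have "ball 0 1 \<inter> last_coords n m \<subseteq> orth_proj (last_coords n m) ` K'"
  proof
    fix v assume v: "v \<in> ball 0 1 \<inter> last_coords n m"
    then have "(norm v)\<^sup>2 < 1" by (simp add: power_less_one_iff)
    \<comment> \<open>The direction over \<open>\<theta>\<^sub>0\<close> whose segment is centred at height \<open>v\<close>.\<close>
    define s where "s = sqrt (1 - (norm v)\<^sup>2)"
    have s: "s > 0" "s\<^sup>2 = 1 - (norm v)\<^sup>2" using \<open>(norm v)\<^sup>2 < 1\<close> by (auto simp: s_def)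
    define \<theta> where "\<theta> = s *\<^sub>R \<theta>\<^sub>0 + v"
    have sR: "s *\<^sub>R \<theta>\<^sub>0 \<in> Rn n" using \<theta>0 by (simp add: subspace_scale[OF subspace_Rn])
    have p\<theta>: "p \<theta> = s *\<^sub>R \<theta>\<^sub>0" unfolding p_def \<theta>_def using sR v by (intro orth_proj_Rn_add) auto
    have sgn\<theta>: "sgn (p \<theta>) = \<theta>\<^sub>0" using s \<theta>0 by (simp add: p\<theta> sgn_div_norm)
    have "orthogonal (s *\<^sub>R \<theta>\<^sub>0) v" using sR v by (intro orthogonal_Rn_last_coords) auto
    then have "(norm \<theta>)\<^sup>2 = s\<^sup>2 + (norm v)\<^sup>2"
      unfolding \<theta>_def using \<theta>0 by (subst norm_add_Pythagorean) (simp_all add: power_mult_distrib)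
    then have "(norm \<theta>)\<^sup>2 = 1\<^sup>2" using s by simp
    then have "norm \<theta> = 1" by (rule power2_eq_imp_eq) auto
    moreover have "\<theta> \<in> Rn (n + m)"
      unfolding \<theta>_def using sR v WR Rn_mono[of n "n + m"] by (intro subspace_add[OF subspace_Rn]) auto
    ultimately have "\<theta> \<in> \<Omega>'" using s \<theta>0 sgn\<theta> by (auto simp: \<Omega>'_def unit_sphere_iff p\<theta>)
    then have "a' \<theta> \<in> K'" unfolding K'_def using center_in_unit_segment by blast
    moreover have "a' \<theta> = a \<theta>\<^sub>0 + v" unfolding a'_def sgn\<theta> by (simp add: p\<theta>) (simp add: \<theta>_def)
    moreover have "orth_proj (last_coords n m) (a \<theta>\<^sub>0 + v) = v"
      using \<Omega>(5)[OF \<theta>0(3)] v by (intro orth_proj_last_coords_add) auto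
    ultimately show "v \<in> orth_proj (last_coords n m) ` K'" by (metis imageI)
  qed
  ultimately show thesis by (rule that)
qed

section \<open>The equivalence of the two conjectures\<close>

lemma hausdorff_dim_projection_of_kakeya_set:
  assumes conj: "\<And>n K. 2 \<le> n \<Longrightarrow> kakeya_set n K \<Longrightarrow> hausdorff_dim K = ereal (real n)"
    and K: "kakeya_set n K" and V: "V \<in> grassmannian n k" and "0 < k"
  shows "hausdorff_dim (orth_proj V ` K) = ereal (real k)"
proof (rule antisym)
  have "orth_proj V ` K \<subseteq> V" using orth_proj(1)[OF V] by blast
  then show "hausdorff_dim (orth_proj V ` K) \<le> ereal (real k)"
    using V bounded_orth_proj[OF V kakeya_set_bounded[OF K]] by (intro hausdorff_dim_grassmannian_le)
  obtain K' where K': "kakeya_set k K'" "hausdorff_dim K' \<le> hausdorff_dim (orth_proj V ` K)"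
    using K V \<open>0 < k\<close> by (rule kakeya_set_in_projection)
  have "ereal (real k) \<le> hausdorff_dim K'"
  proof (cases "k = 1")
    case True
    then show ?thesis using hausdorff_dim_kakeya_set_1 K'(1) by (simp add: one_ereal_def)
  next
    case False
    then show ?thesis using conj[OF _ K'(1)] \<open>0 < k\<close> by simp
  qed
  then show "ereal (real k) \<le> hausdorff_dim (orth_proj V ` K)" using K'(2) by (rule order.trans)
qed

text \<open>
  If all projections of the extended set to \<open>n\<close>-dimensional subspaces of \<open>\<real>\<^sup>2\<^sup>n\<close> have the same dimension,
  the shadow contained in \<open>K\<close> is as large as the one containing a ball.
\<close>

lemma hausdorff_dim_kakeya_set_of_constant_projections:
  assumes "0 < n" and K: "kakeya_set n K"
    and const: "\<And>K'. kakeya_set (n + n) K' \<Longrightarrow>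
      \<exists>c. \<forall>\<gamma>\<in>grassmannian (n + n) n. hausdorff_dim (orth_proj \<gamma> ` K') = c"
  shows "hausdorff_dim K = ereal (real n)"
proof (rule antisym)
  show "hausdorff_dim K \<le> ereal (real n)"
    using kakeya_set_subset_Rn[OF K] kakeya_set_bounded[OF K] by (rule hausdorff_dim_Rn_le)
  obtain K' where K': "kakeya_set (n + n) K'" "orth_proj (Rn n) ` K' \<subseteq> K"
    "ball 0 1 \<inter> last_coords n n \<subseteq> orth_proj (last_coords n n) ` K'"
    using K by (rule kakeya_set_extension)
  have "ereal (real n) \<le> hausdorff_dim (orth_proj (last_coords n n) ` K')"
    by (rule hausdorff_dim_grassmannian_ge[OF last_coords_in_grassmannian \<open>0 < n\<close> zero_less_one _ K'(3)])
      (simp add: last_coords_def span_zero)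
  also have "\<dots> = hausdorff_dim (orth_proj (Rn n) ` K')"
    using const[OF K'(1)] last_coords_in_grassmannian[of n n] Rn_in_grassmannian[of n n] by metis
  also have "\<dots> \<le> hausdorff_dim K" using K'(2) by (rule hausdorff_dim_mono)
  finally show "ereal (real n) \<le> hausdorff_dim K" .
qed

theorem theorem1p6:
  shows "(\<forall>n\<ge>2. \<forall>K. kakeya_set n K \<longrightarrow> hausdorff_dim K = ereal (real n))
    \<longleftrightarrow>
    (\<forall>n\<ge>2. \<forall>K. kakeya_set n K \<longrightarrow>
       (\<forall>k. 0 < k \<and> k < n \<longrightarrow>
          (\<exists>c::real. \<forall>\<gamma>\<in>grassmannian n k. hausdorff_dim (orth_proj \<gamma> ` K) = ereal c)))"
proof (intro iffI allI impI)
  fix n k :: nat and K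
  assume "\<forall>n\<ge>2. \<forall>K. kakeya_set n K \<longrightarrow> hausdorff_dim K = ereal (real n)"
    and "kakeya_set n K" "0 < k \<and> k < n"
  then have "\<forall>\<gamma>\<in>grassmannian n k. hausdorff_dim (orth_proj \<gamma> ` K) = ereal (real k)"
    using hausdorff_dim_projection_of_kakeya_set by blast
  then show "\<exists>c::real. \<forall>\<gamma>\<in>grassmannian n k. hausdorff_dim (orth_proj \<gamma> ` K) = ereal c" ..
next
  fix n :: nat and K
  assume proj: "\<forall>n\<ge>2. \<forall>K. kakeya_set n K \<longrightarrow>
       (\<forall>k. 0 < k \<and> k < n \<longrightarrow>
          (\<exists>c::real. \<forall>\<gamma>\<in>grassmannian n k. hausdorff_dim (orth_proj \<gamma> ` K) = ereal c))"
    and n: "2 \<le> n" and K: "kakeya_set n K"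
  show "hausdorff_dim K = ereal (real n)"
  proof (rule hausdorff_dim_kakeya_set_of_constant_projections[OF _ K])
    fix K' assume "kakeya_set (n + n) K'"
    moreover have "2 \<le> n + n" "0 < n \<and> n < n + n" using n by auto
    ultimately show "\<exists>c. \<forall>\<gamma>\<in>grassmannian (n + n) n. hausdorff_dim (orth_proj \<gamma> ` K') = c"
      using proj by meson
  qed (use n in simp)
qed

end
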